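(* The family $(\mathsf{HC}_n)_{n\ge 1}$ of non-commutative Hamiltonian cycle polynomials is $\mathsf{VNP}_{\mathsf{A,\overline{C}}}$-complete under $p$-projections.
   Context: Fix a field $\mathbb{F}$ of characteristic $0$. All polynomials are elements of a free associative (non-commutative) algebra $\mathbb{F}\langle X\rangle$ over a set of variables $X$. For each $n$, with variables $x_{i,j}$ ($i,j\in[n]$), let $C_n\subseteq\mathsf{Sym}_n$ be the set of permutations consisting of a single cycle of length $n$, and define $\mathsf{HC}_n = \sum_{\sigma\in C_n} x_{1,\sigma(1)}\,x_{\sigma(1),\sigma^2(1)}\,x_{\sigma^2(1),\sigma^3(1)}\cdots x_{\sigma^{n-1}(1),1}$ (product in the indicated order). A family $(f_n)$ of non-commutative polynomials is in $\mathsf{VP}_{\mathsf{A,\overline{C}}}$ if the number of variables and the degree of $f_n$ are polynomially bounded in $n$ and $f_n$ is computed by an arithmetic circuit over $\mathbb{F}$ of size polynomial in $n$ whose multiplication gates are non-commutative (associative) with ordered inputs. $(f_n)$ is in $\mathsf{VNP}_{\mathsf{A,\overline{C}}}$ if there are a polynomially bounded $m(n)$ and $(g_n)\in\mathsf{VP}_{\mathsf{A,\overline{C}}}$ with $f_n(x)=\sum_{e\in\{0,1\}^{m(n)}} g_n(x,e)$. A family $(f_n)$ is a $p$-projection of $(g_n)$ if there is a polynomially bounded $t(n)$ such that $f_n$ is obtained from $g_{t(n)}$ by substituting each variable by a variable or a constant from $\mathbb{F}$. $\mathsf{VNP}_{\mathsf{A,\overline{C}}}$-completeness under $p$-projections means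 membership in $\mathsf{VNP}_{\mathsf{A,\overline{C}}}$ and every family in $\mathsf{VNP}_{\mathsf{A,\overline{C}}}$ is a $p$-projection of it. *)

theory Defs
  imports
    "HOL-Library.Poly_Mapping"
    "HOL-Library.FuncSet"
    "HOL-Computational_Algebra.Polynomial"
    "HOL-Combinatorics.Orbits"
begin

section \<open>The free associative algebra\<close>

text \<open>
  Words over \<open>'x\<close> form the free monoid. It is written additively because \<open>Poly_Mapping\<close> defines
  the convolution product over \<open>monoid_add\<close>; that product on finitely supported functions then
  makes \<open>('x, 'a) ncpoly\<close> the free associative algebra over \<open>'a\<close> in the variables \<open>'x\<close>.
\<close>

datatype 'x nc_word = Word (letters: "'x list")

instantiation nc_word :: (type) monoid_add
begin

definition "0 = Word []"
definition "u + v = Word (letters u @ letters v)"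

instance
  by standard (simp_all add: zero_nc_word_def plus_nc_word_def)

end

type_synonym ('x, 'a) ncpoly = "'x nc_word \<Rightarrow>\<^sub>0 'a"

definition nc_const :: "'a \<Rightarrow> ('x, 'a::zero) ncpoly" where
  "nc_const c = Poly_Mapping.single 0 c"

definition nc_var :: "'x \<Rightarrow> ('x, 'a::zero_neq_one) ncpoly" where
  "nc_var x = Poly_Mapping.single (Word [x]) 1"

definition nc_vars :: "('x, 'a::zero) ncpoly \<Rightarrow> 'x set" where
  "nc_vars f = (\<Union>w\<in>Poly_Mapping.keys f. set (letters w))"

text \<open>The zero polynomial gets degree \<open>0\<close>.\<close>

definition nc_degree :: "('x, 'a::zero) ncpoly \<Rightarrow> nat" where
  "nc_degree f = Max (insert 0 ((\<lambda>w. length (letters w)) ` Poly_Mapping.keys f))"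

definition nc_subst ::
  "('x \<Rightarrow> ('y, 'a) ncpoly) \<Rightarrow> ('x, 'a::semiring_1) ncpoly \<Rightarrow> ('y, 'a) ncpoly" where
  "nc_subst s f =
     (\<Sum>w\<in>Poly_Mapping.keys f.
        nc_const (Poly_Mapping.lookup f w) * prod_list (map s (letters w)))"


section \<open>Arithmetic circuits\<close>

text \<open>
  A circuit is the list of its gates in a topological order: the inputs of a binary gate are given
  by the positions of two (possibly equal) earlier gates, and the last gate is the output. The size
  is the number of gates. For \<open>Mult i j\<close> the order of the inputs matters.
\<close>

datatype ('x, 'a) gate = Input 'x | Const 'a | Add nat nat | Mult nat nat

type_synonym ('x, 'a) circuit = "('x, 'a) gate list"

fun gate_inputs :: "('x, 'a) gate \<Rightarrow> nat set" where
  "gate_inputs (Input x) = {}"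
| "gate_inputs (Const c) = {}"
| "gate_inputs (Add i j) = {i, j}"
| "gate_inputs (Mult i j) = {i, j}"

definition wf_circuit :: "('x, 'a) circuit \<Rightarrow> bool" where
  "wf_circuit C \<longleftrightarrow> C \<noteq> [] \<and> (\<forall>k<length C. gate_inputs (C ! k) \<subseteq> {..<k})"

fun gate_value ::
  "('x, 'a) ncpoly list \<Rightarrow> ('x, 'a::semiring_1) gate \<Rightarrow> ('x, 'a) ncpoly" where
  "gate_value vs (Input x) = nc_var x"
| "gate_value vs (Const c) = nc_const c"
| "gate_value vs (Add i j) = vs ! i + vs ! j"
| "gate_value vs (Mult i j) = vs ! i * vs ! j"

definition circuit_values :: "('x, 'a::semiring_1) circuit \<Rightarrow> ('x, 'a) ncpoly list" where
  "circuit_values C = foldl (\<lambda>vs g. vs @ [gate_value vs g]) [] C"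

definition computes :: "('x, 'a::semiring_1) circuit \<Rightarrow> ('x, 'a) ncpoly \<Rightarrow> bool" where
  "computes C f \<longleftrightarrow> wf_circuit C \<and> last (circuit_values C) = f"


section \<open>Complexity classes and projections\<close>

text \<open>
  Families are indexed by the integers \<open>n \<ge> 1\<close>; the value of a function at \<open>0\<close> is irrelevant
  throughout.
\<close>

definition p_bounded :: "(nat \<Rightarrow> nat) \<Rightarrow> bool" where
  "p_bounded t \<longleftrightarrow> (\<exists>p :: nat poly. \<forall>n\<ge>1. t n \<le> poly p n)"

definition VP :: "(nat \<Rightarrow> ('x, 'a::semiring_1) ncpoly) set" where
  "VP = {f. p_bounded (\<lambda>n. card (nc_vars (f n))) \<and>
            p_bounded (\<lambda>n. nc_degree (f n)) \<and>
            (\<exists>C. p_bounded (\<lambda>n. length (C n)) \<and> (\<forall>n\<ge>1. computes (C n) (f n)))}"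

text \<open>
  In \<open>g n\<close>, the variables \<open>Inl x\<close> are the variables of \<open>f n\<close>, and
  \<open>Inr 0, \<dots>, Inr (m n - 1)\<close> are the ones summed over.
\<close>

definition VNP :: "(nat \<Rightarrow> ('x, 'a::semiring_1) ncpoly) set" where
  "VNP = {f. \<exists>m. \<exists>g :: nat \<Rightarrow> ('x + nat, 'a) ncpoly. p_bounded m \<and> g \<in> VP \<and>
            (\<forall>n\<ge>1. nc_vars (g n) \<subseteq> range Inl \<union> Inr ` {..<m n} \<and>
               f n = (\<Sum>e\<in>{..<m n} \<rightarrow>\<^sub>E {0, 1}.
                        nc_subst (case_sum nc_var (\<lambda>i. nc_const (e i))) (g n)))}"

definition projection :: "('x, 'a::semiring_1) ncpoly \<Rightarrow> ('y, 'a) ncpoly \<Rightarrow> bool" where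
  "projection f g \<longleftrightarrow> (\<exists>s. range s \<subseteq> range nc_var \<union> range nc_const \<and> f = nc_subst s g)"

definition p_projection ::
  "(nat \<Rightarrow> ('x, 'a::semiring_1) ncpoly) \<Rightarrow> (nat \<Rightarrow> ('y, 'a) ncpoly) \<Rightarrow> bool" where
  "p_projection f g \<longleftrightarrow> (\<exists>t. p_bounded t \<and> (\<forall>n\<ge>1. t n \<ge> 1 \<and> projection (f n) (g (t n))))"

text \<open>
  The type argument is the set of variables of the families that are to be projections of \<open>h\<close>;
  the variables of \<open>h\<close> itself are unrelated to it.
\<close>

definition VNP_complete :: "'x itself \<Rightarrow> (nat \<Rightarrow> ('y, 'a::semiring_1) ncpoly) \<Rightarrow> bool" where
  "VNP_complete _ h \<longleftrightarrow>
     h \<in> VNP \<and> (\<forall>f :: nat \<Rightarrow> ('x, 'a) ncpoly. f \<in> VNP \<longrightarrow> p_projection f h)"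


section \<open>Hamiltonian cycle polynomials\<close>

definition full_cycles :: "nat \<Rightarrow> (nat \<Rightarrow> nat) set" where
  "full_cycles n = {p. p permutes {1..n} \<and> cyclic_on p {1..n}}"

text \<open>The last factor is the one required, since \<open>(p ^^ n) 1 = 1\<close> for \<open>p \<in> full_cycles n\<close>.\<close>

definition HC :: "nat \<Rightarrow> (nat \<times> nat, 'a::semiring_1) ncpoly" where
  "HC n = (\<Sum>p\<in>full_cycles n.
             prod_list (map (\<lambda>k. nc_var ((p ^^ k) 1, (p ^^ Suc k) 1)) [0..<n]))"

end

theory Submission
  imports Defs "HOL-Combinatorics.Cycles"
begin

text \<open>
  Hardness. Split off constant terms and take homogeneous components: a circuit of polynomial degree
  becomes a weighted grammar in Chomsky normal form, so its polynomial is a sum over parse trees with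
  polynomially many leaves. Written in preorder, a parse tree is an assignment of node descriptions to
  positions subject to weighted constraints between pairs of positions, and the summed boolean
  variables are further positions. Such a weighted sum over assignments is realised by the Hamiltonian
  cycles of a graph of polynomial size. A cycle first passes the positions in order, reading off the
  word of the parse tree and using up the vertices of all values that are not chosen; on its way back
  it has to collect the remaining vertices, in an order that puts every two positions next to each
  other, and picks up the weight of every constraint.

  Membership. Guess the 0/1 matrix that says which vertex is at which position of the cycle; its
  validity is checked by a product of polynomially many small factors.
\<close>

section \<open>Substitution\<close>

text \<open>Two obstacles shape the construction. The variables of a monomial must occur along the
  cycle in the order of the word, while a constraint may relate positions far apart. Scalars are
  central, so their place does not matter: the first pass only spells the word, and all weights wait
  for the way back, whose steps can be arranged freely. A step sees only two neighbouring choices,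
  hence constraints between pairs. A choice has to be remembered between its many visits; it is
  stored negatively, as the set of vertices that the first pass has left over. The second obstacle
  is that a small circuit with output of small degree may have intermediate results of exponential
  degree, so its own parse trees are too large. Homogeneous components up to the output degree avoid
  this. Factors of degree 0 would still lengthen trees without adding degree; once they are absorbed
  into linear coefficients, both sides of every product have positive degree, and the number of
  leaves bounds the tree.\<close>

lemma nc_const_0 [simp]: "nc_const 0 = 0"
  by (simp add: nc_const_def)

lemma nc_const_1 [simp]: "nc_const 1 = 1"
  by (simp add: nc_const_def single_one)

lemma nc_const_add: "nc_const (a + b) = nc_const a + nc_const b"
  by (simp add: nc_const_def single_add)

lemma nc_const_mult: "nc_const (a * b) = nc_const a * nc_const b"
  by (simp add: nc_const_def mult_single)

text \<open>Additive and bilinear identities then need to be checked on monomials only.\<close>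

lemma ncpoly_induct [case_names single add]:
  fixes f :: "'k \<Rightarrow>\<^sub>0 'a::comm_monoid_add"
  assumes "\<And>k v. P (Poly_Mapping.single k v)" and "\<And>f g. P f \<Longrightarrow> P g \<Longrightarrow> P (f + g)"
  shows "P f"
proof -
  have "P (\<Sum>k\<in>K. Poly_Mapping.single k (Poly_Mapping.lookup f k))" if "finite K" for K
    using that
  proof induction
    case empty
    show ?case using assms(1)[of undefined 0] by simp
  qed (simp add: assms)
  moreover have "f = (\<Sum>k\<in>Poly_Mapping.keys f. Poly_Mapping.single k (Poly_Mapping.lookup f k))"
    by (rule poly_mapping_eqI) (auto simp: lookup_sum lookup_single when_def in_keys_iff)
  ultimately show ?thesis
    by (metis finite_keys)
qed

text \<open>Scalars are central because the coefficients commute; weights are moved past words by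
  this fact.\<close>

lemma nc_const_commute: "f * nc_const c = nc_const c * f"
  for c :: "'a::comm_semiring_1"
proof (induction f rule: ncpoly_induct)
  case (single k v)
  show ?case by (simp add: nc_const_def mult_single mult.commute)
qed (simp add: algebra_simps)

lemma nc_subst_superset:
  assumes "finite S" "Poly_Mapping.keys f \<subseteq> S"
  shows "nc_subst s f = (\<Sum>w\<in>S. nc_const (Poly_Mapping.lookup f w) * prod_list (map s (letters w)))"
  unfolding nc_subst_def
  by (rule sum.mono_neutral_left) (use assms in \<open>auto simp: in_keys_iff\<close>)

lemma nc_subst_0 [simp]: "nc_subst s 0 = 0"
  by (simp add: nc_subst_def)

lemma nc_subst_add: "nc_subst s (f + g) = nc_subst s f + nc_subst s g"
proof -
  let ?S = "Poly_Mapping.keys f \<union> Poly_Mapping.keys g"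
  have "Poly_Mapping.keys (f + g) \<subseteq> ?S" by (rule Poly_Mapping.keys_add)
  then show ?thesis
    by (simp add: nc_subst_superset[of ?S] lookup_add nc_const_add distrib_right sum.distrib)
qed

lemma nc_subst_single:
  "nc_subst s (Poly_Mapping.single w c) = nc_const c * prod_list (map s (letters w))"
  by (cases "c = 0") (simp_all add: nc_subst_def)

lemma nc_subst_const [simp]: "nc_subst s (nc_const c) = nc_const c"
  using nc_subst_single[of s 0 c] by (simp add: nc_const_def zero_nc_word_def)

lemma nc_subst_1 [simp]: "nc_subst s 1 = 1"
  using nc_subst_const[of s 1] by simp

lemma nc_subst_var [simp]: "nc_subst s (nc_var x) = s x"
  by (simp add: nc_var_def nc_subst_single)

lemma nc_subst_mult: "nc_subst s (f * g) = nc_subst s f * nc_subst s g"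
  for f :: "('x, 'a::comm_semiring_1) ncpoly"
proof (induction f arbitrary: g rule: ncpoly_induct)
  case (single k v)
  show ?case
  proof (induction g rule: ncpoly_induct)
    case (single l c)
    let ?k = "prod_list (map s (letters k))" and ?l = "prod_list (map s (letters l))"
    have "nc_const v * ?k * (nc_const c * ?l) = nc_const v * (?k * nc_const c) * ?l"
      by (simp only: mult.assoc)
    also have "\<dots> = nc_const (v * c) * (?k * ?l)"
      by (simp only: nc_const_commute[of ?k] nc_const_mult mult.assoc)
    finally show ?case
      by (simp add: mult_single nc_subst_single plus_nc_word_def)
  qed (simp add: distrib_left nc_subst_add)
qed (simp add: distrib_right nc_subst_add)

lemma nc_subst_sum: "nc_subst s (sum f I) = (\<Sum>i\<in>I. nc_subst s (f i))"
  by (induction I rule: infinite_finite_induct) (simp_all add: nc_subst_add)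

lemma nc_subst_prod_list: "nc_subst s (prod_list fs) = prod_list (map (nc_subst s) fs)"
  for fs :: "('x, 'a::comm_semiring_1) ncpoly list"
  by (induction fs) (simp_all add: nc_subst_mult)

lemma nc_subst_sum_list: "nc_subst s (sum_list fs) = sum_list (map (nc_subst s) fs)"
  by (induction fs) (simp_all add: nc_subst_add)

lemma nc_subst_cong:
  assumes "\<And>x. x \<in> nc_vars f \<Longrightarrow> s x = s' x"
  shows "nc_subst s f = nc_subst s' f"
  unfolding nc_subst_def
proof (rule sum.cong)
  fix w assume "w \<in> Poly_Mapping.keys f"
  then have "map s (letters w) = map s' (letters w)"
    using assms by (auto simp: nc_vars_def)
  then show "nc_const (Poly_Mapping.lookup f w) * prod_list (map s (letters w)) =
    nc_const (Poly_Mapping.lookup f w) * prod_list (map s' (letters w))" by (simp only:)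
qed simp

section \<open>Hamiltonian cycles as vertex lists\<close>

definition ham_lists :: "'v set \<Rightarrow> 'v \<Rightarrow> 'v list set" where
  "ham_lists V v = {xs. distinct xs \<and> set xs = V \<and> xs \<noteq> [] \<and> hd xs = v}"

fun walk :: "('v \<Rightarrow> 'v \<Rightarrow> 'b::monoid_mult) \<Rightarrow> 'v list \<Rightarrow> 'b" where
  "walk w (x # y # zs) = w x y * walk w (y # zs)"
| "walk w zs = 1"

lemma walk_append: "walk w (xs @ y # zs) = walk w (xs @ [y]) * walk w (y # zs)"
proof (induction xs)
  case (Cons x xs)
  then show ?case by (cases xs) (simp_all add: mult.assoc)
qed simp

lemma walk_nth: "walk w xs = prod_list (map (\<lambda>k. w (xs ! k) (xs ! Suc k)) [0..<length xs - 1])"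
proof (induction w xs rule: walk.induct)
  case (1 w x y zs)
  have "[0..<length (x # y # zs) - 1] = 0 # map Suc [0..<length (y # zs) - 1]"
    by (simp add: upt_conv_Cons map_Suc_upt del: upt_Suc)
  then show ?case using 1 by (simp add: o_def)
qed simp_all

lemma finite_ham_lists [simp]: "finite (ham_lists V v)" if "finite V"
  by (rule finite_subset[OF _ finite_lists_length_eq[OF that, of "card V"]])
    (auto simp: ham_lists_def distinct_card)

text \<open>\<open>cycle_of_list xs\<close> maps each entry to the next, so its powers at the head
  run through the list. Arguments about a cycle can then use that predecessors are unique.\<close>

lemma ham_list_permutation:
  assumes "xs \<in> ham_lists V v"
  obtains p where "p permutes V" "\<And>k. k < length xs \<Longrightarrow> (p ^^ k) v = xs ! k"
    "(p ^^ length xs) v = v"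
proof
  have xs: "distinct xs" "set xs = V" "xs \<noteq> []" "v = xs ! 0"
    using assms by (auto simp: ham_lists_def hd_conv_nth)
  let ?p = "cycle_of_list xs"
  show "?p permutes V"
    using cycle_permutes[of xs] xs by simp
  have "(?p ^^ k) v = xs ! (k mod length xs)" for k
  proof -
    have "map (?p ^^ k) xs ! 0 = rotate k xs ! 0"
      using cyclic_rotation[OF xs(1), of k] by simp
    then show ?thesis
      using xs(3,4) by (simp add: nth_rotate)
  qed
  then show "k < length xs \<Longrightarrow> (?p ^^ k) v = xs ! k" "(?p ^^ length xs) v = v" for k
    using xs(4) by simp_all
qed

text \<open>Up to its first return the orbit of 1 has no repetition and exhausts
  \<open>{1..n}\<close>, so the return happens after exactly \<open>n\<close> steps.\<close>

lemma full_cycle_orbit: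
  assumes "p \<in> full_cycles n" "n \<ge> 1"
  shows "(p ^^ n) 1 = 1" "distinct (map (\<lambda>k. (p ^^ k) 1) [0..<n])"
    "(\<lambda>k. (p ^^ k) 1) ` {..<n} = {1..n}"
proof -
  have p: "p permutes {1..n}" "cyclic_on p {1..n}"
    using assms by (auto simp: full_cycles_def)
  then have perm: "permutation p" by (auto simp: permutation_permutes)
  let ?m = "least_power p 1"
  have m: "(p ^^ ?m) 1 = 1" "?m > 0"
    using least_power_of_permutation[OF perm] by auto
  have orb: "orbit p 1 = {1..n}"
    using p(2) assms(2) by (auto simp: cyclic_on_alldef)
  then have S: "(\<lambda>k. (p ^^ k) 1) ` {..<?m} = {1..n}"
    using orbit_altdef_bounded[OF m] by auto
  have d: "distinct (map (\<lambda>k. (p ^^ k) 1) [0..<?m])"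
    using cycle_of_permutation[OF perm, of 1] .
  have "?m = n"
    using distinct_card[OF d] S by (simp add: lessThan_atLeast0)
  then show "(p ^^ n) 1 = 1" "distinct (map (\<lambda>k. (p ^^ k) 1) [0..<n])"
    "(\<lambda>k. (p ^^ k) 1) ` {..<n} = {1..n}"
    using m S d by auto
qed

lemma bij_betw_full_cycles_ham_lists:
  assumes "n \<ge> 1"
  shows "bij_betw (\<lambda>p. map (\<lambda>k. (p ^^ k) 1) [0..<n]) (full_cycles n) (ham_lists {1..n} 1)"
    (is "bij_betw ?\<Phi> _ _")
proof (rule bij_betwI')
  fix p q assume pq: "p \<in> full_cycles n" "q \<in> full_cycles n"
  show "(?\<Phi> p = ?\<Phi> q) = (p = q)"
  proof
    assume eq: "?\<Phi> p = ?\<Phi> q"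
    \<comment> \<open>The case \<open>k = n\<close> is included because the successor of the last
      vertex is read off there.\<close>
    have k: "(p ^^ k) 1 = (q ^^ k) 1" if "k \<le> n" for k
      using that eq full_cycle_orbit(1)[OF pq(1) assms] full_cycle_orbit(1)[OF pq(2) assms]
      by (cases "k = n") auto
    show "p = q"
    proof
      fix x
      show "p x = q x"
      proof (cases "x \<in> {1..n}")
        case True
        then obtain k where "k < n" "x = (p ^^ k) 1"
          using full_cycle_orbit(3)[OF pq(1) assms] by blast
        then show ?thesis using k[of k] k[of "Suc k"] by simp
      next
        case False
        then show ?thesis
          using pq by (auto simp: full_cycles_def permutes_not_in)
      qed
    qed
  qed simp
next
  fix p assume "p \<in> full_cycles n"
  from full_cycle_orbit[OF this assms] show "?\<Phi> p \<in> ham_lists {1..n} 1"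
    using assms by (auto simp: ham_lists_def hd_map lessThan_atLeast0)
next
  fix xs assume xs: "xs \<in> ham_lists {1..n} (1::nat)"
  then have len: "length xs = n"
    by (auto simp: ham_lists_def dest: distinct_card)
  obtain p where p: "p permutes {1..n}" "\<And>k. k < n \<Longrightarrow> (p ^^ k) 1 = xs ! k" "(p ^^ n) 1 = 1"
    using ham_list_permutation[OF xs] len by metis
  have "orbit p 1 = {(p ^^ k) 1 |k. k < n}"
    using p(3) assms by (intro orbit_altdef_bounded) auto
  also have "\<dots> = set xs"
    using p(2) len unfolding set_conv_nth by (metis (no_types, lifting))
  finally have "cyclic_on p {1..n}"
    using xs assms by (auto simp: cyclic_on_def ham_lists_def intro!: bexI[of _ 1])
  then show "\<exists>p\<in>full_cycles n. xs = ?\<Phi> p"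
    using p len by (intro bexI[of _ p]) (auto simp: full_cycles_def intro!: nth_equalityI)
qed

lemma HC_ham_lists:
  assumes "n \<ge> 1"
  shows "HC n = (\<Sum>xs\<in>ham_lists {1..n} 1. walk (\<lambda>i j. nc_var (i, j)) (xs @ [1]))"
  unfolding HC_def
proof (rule trans[OF _ sum.reindex_bij_betw[OF bij_betw_full_cycles_ham_lists[OF assms]]])
  show "(\<Sum>p\<in>full_cycles n. prod_list (map (\<lambda>k. nc_var ((p ^^ k) 1, (p ^^ Suc k) 1)) [0..<n])) =
    (\<Sum>p\<in>full_cycles n. walk (\<lambda>i j. nc_var (i, j)) (map (\<lambda>k. (p ^^ k) 1) [0..<n] @ [1]))"
  proof (rule sum.cong)
    fix p assume "p \<in> full_cycles n"
    then have "map (\<lambda>k. (p ^^ k) 1) [0..<n] @ [1] = map (\<lambda>k. (p ^^ k) 1) [0..<Suc n]"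
      using full_cycle_orbit(1)[of p n] assms by simp
    then show "prod_list (map (\<lambda>k. nc_var ((p ^^ k) 1, (p ^^ Suc k) 1)) [0..<n]) =
      walk (\<lambda>i j. nc_var (i, j)) (map (\<lambda>k. (p ^^ k) 1) [0..<n] @ [1])"
      by (simp only: walk_nth) (auto simp del: upt_Suc intro!: arg_cong[where f=prod_list] map_cong)
  qed simp
qed

lemma ham_sum_projection:
  fixes w :: "'v \<Rightarrow> 'v \<Rightarrow> ('x, 'a::comm_semiring_1) ncpoly"
  assumes "finite V" "v \<in> V" and w: "\<And>x y. w x y \<in> range nc_var \<union> range nc_const"
  shows "projection (\<Sum>xs\<in>ham_lists V v. walk w (xs @ [v])) (HC (card V))"
proof -
  let ?n = "card V"
  have n: "?n \<ge> 1" using assms(1,2) by (auto simp: Suc_le_eq card_gt_0_iff)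
  obtain \<phi>0 where \<phi>0: "bij_betw \<phi>0 {1..?n} V"
    using assms(1) by (metis ex_bij_betw_nat_finite_1)
  obtain i0 where i0: "i0 \<in> {1..?n}" "\<phi>0 i0 = v"
    using assms(2) bij_betw_imp_surj_on[OF \<phi>0] by (metis imageE)
  \<comment> \<open>The starting point of the word matters, so a swap makes \<open>v\<close> vertex
    number 1.\<close>
  define \<phi> where "\<phi> = \<phi>0 \<circ> transpose 1 i0"
  have "bij_betw (transpose 1 i0) {1..?n} {1..?n}"
    using permutes_swap_id[of 1 "{1..?n}" i0] i0 n by (intro permutes_imp_bij) auto
  then have \<phi>: "bij_betw \<phi> {1..?n} V"
    unfolding \<phi>_def using \<phi>0 by (rule bij_betw_trans)
  have \<phi>1: "\<phi> 1 = v" using i0 by (simp add: \<phi>_def)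
  define s where "s = (\<lambda>(i, j). w (\<phi> i) (\<phi> j))"
  have inj: "inj_on \<phi> {1..?n}" "\<phi> ` {1..?n} = V" using \<phi> by (auto simp: bij_betw_def)
  have bij: "bij_betw (map \<phi>) (ham_lists {1..?n} 1) (ham_lists V v)"
  proof (rule bij_betwI[where g="map (inv_into {1..?n} \<phi>)"])
    show "map \<phi> \<in> ham_lists {1..?n} 1 \<rightarrow> ham_lists V v"
      using inj \<phi>1 by (auto simp: ham_lists_def distinct_map hd_map)
    have inv: "bij_betw (inv_into {1..?n} \<phi>) V {1..?n}"
      using \<phi> by (rule bij_betw_inv_into)
    have inv1: "inv_into {1..?n} \<phi> v = 1"
      using inj(1) \<phi>1 n by (metis atLeastAtMost_iff inv_into_f_f le_refl)
    show "map (inv_into {1..?n} \<phi>) \<in> ham_lists V v \<rightarrow> ham_lists {1..?n} 1"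
      using inv inv1 by (auto simp: ham_lists_def distinct_map hd_map bij_betw_def)
  next
    fix xs assume "xs \<in> ham_lists {1..?n} 1"
    then show "map (inv_into {1..?n} \<phi>) (map \<phi> xs) = xs"
      using inj by (auto simp: ham_lists_def intro!: map_idI)
  next
    fix xs assume "xs \<in> ham_lists V v"
    then show "map \<phi> (map (inv_into {1..?n} \<phi>) xs) = xs"
      using inj by (auto simp: ham_lists_def f_inv_into_f intro!: map_idI)
  qed
  have sub: "nc_subst s (walk (\<lambda>i j. nc_var (i, j)) ys) = walk w (map \<phi> ys)" for ys
    by (auto simp: walk_nth nc_subst_prod_list s_def intro!: arg_cong[where f=prod_list])
  have "nc_subst s (HC ?n) = (\<Sum>xs\<in>ham_lists {1..?n} 1. walk w (map \<phi> xs @ [v]))"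
    using \<phi>1 by (simp add: HC_ham_lists[OF n] nc_subst_sum sub)
  also have "\<dots> = (\<Sum>xs\<in>ham_lists V v. walk w (xs @ [v]))"
    by (rule sum.reindex_bij_betw[OF bij])
  finally have "(\<Sum>xs\<in>ham_lists V v. walk w (xs @ [v])) = nc_subst s (HC ?n)" ..
  moreover have "range s \<subseteq> range nc_var \<union> range nc_const"
    using w by (auto simp: s_def)
  ultimately show ?thesis by (auto simp: projection_def)
qed

section \<open>Exact covers as Hamiltonian cycles\<close>

lemma prod_list_zero: "0 \<in> set xs \<Longrightarrow> prod_list xs = 0" for xs :: "'b::semiring_1 list"
  by (induction xs) auto

lemma successively_glue:
  "successively P (xs @ [x]) \<Longrightarrow> successively P (x # ys) \<Longrightarrow> successively P (xs @ x # ys)"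
  by (auto simp: successively_append_iff)

text \<open>Both lists enumerate the powers of \<open>p\<close> at \<open>v\<close>: a longer
  \<open>xs\<close> would repeat \<open>v\<close>, and a shorter one would put \<open>v\<close> into
  \<open>ys\<close>.\<close>

lemma ham_list_unique:
  assumes "successively (\<lambda>x y. p x = y) (v # ys @ [v])" "v \<notin> set ys"
    and xs: "distinct xs" "xs \<noteq> []" "\<And>k. k < length xs \<Longrightarrow> (p ^^ k) v = xs ! k" "(p ^^ length xs) v = v"
  shows "xs = v # ys"
proof -
  let ?L = "v # ys"
  have L: "(?L @ [v]) ! k = (p ^^ k) v" if "k \<le> length ?L" for k
    using that
  proof (induction k)
    case (Suc k)
    then have "p ((?L @ [v]) ! k) = (?L @ [v]) ! Suc k"
      using assms(1) unfolding successively_conv_nth by (metis append_Cons length_append_singleton less_Suc_eq_le Suc_le_lessD)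
    then show ?case using Suc by simp
  qed simp
  have "length ?L = length xs"
  proof (rule linorder_cases)
    assume *: "length ?L < length xs"
    have "xs ! length ?L = v" using L[of "length ?L"] xs(3)[OF *] by (simp add: nth_append)
    moreover have "xs ! 0 = v" using xs(2) xs(3)[of 0] by simp
    ultimately show ?thesis using * xs(1,2) by (metis nth_eq_iff_index_eq length_greater_0_conv length_Cons nat.distinct(1))
  next
    assume *: "length xs < length ?L"
    then have "?L ! length xs = v" using L[of "length xs"] xs(4) by (metis less_imp_le_nat nth_append)
    then have "v \<in> set ys" using * xs(2) by (cases "length xs") (auto simp: in_set_conv_nth)
    then show ?thesis using assms(2) by simp
  qed
  then show ?thesis
    using L xs(3) by (intro nth_equalityI) (auto simp: nth_append, metis length_Cons less_imp_le_nat less_Suc_eq_le nth_append append_Cons)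
qed

text \<open>
  The tour first runs through \<open>Hub 0, \<dots>, Hub M\<close>. Between \<open>Hub j\<close> and \<open>Hub (Suc j)\<close> it either uses the
  direct edge, labelled \<open>lab j\<close> (then \<open>j\<close> is in the cover), or crosses all slots \<open>(t, j)\<close> with
  \<open>inc t j\<close> in increasing order of \<open>t\<close>. On the way back from \<open>Hub M\<close> to \<open>Hub 0\<close> it crosses exactly one
  slot \<open>(t, j)\<close> for every \<open>t\<close>, which must be one of those left over. A slot is crossed in the order
  \<open>VA, VB, VC\<close> in the first phase and \<open>VC, VB, VA\<close> in the second. Since the only neighbours of \<open>VB\<close>
  are \<open>VA\<close> and \<open>VC\<close>, a Hamiltonian cycle cannot change phase inside a slot.
\<close>

datatype vertex = Hub nat | VA nat nat | VB nat nat | VC nat nat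

text \<open>The points to be covered are the times \<open>t < S\<close>, the covering sets are the
  numbers \<open>j < M\<close>, and \<open>inc t j\<close> says that \<open>j\<close> covers
  \<open>t\<close>. A weight \<open>wt t j j'\<close> compares the sets chosen for times
  \<open>t\<close> and \<open>t + 1\<close>.\<close>

locale exact_cover =
  fixes M S :: nat and inc :: "nat \<Rightarrow> nat \<Rightarrow> bool"
    and lab :: "nat \<Rightarrow> ('x, 'a::comm_semiring_1) ncpoly" and wt :: "nat \<Rightarrow> nat \<Rightarrow> nat \<Rightarrow> 'a"
  assumes S_pos: "S > 0"
    and covers: "j < M \<Longrightarrow> \<exists>t<S. inc t j"
    and lab: "lab j \<in> range nc_var \<union> range nc_const"
begin

definition slot :: "nat \<Rightarrow> nat \<Rightarrow> bool" where
  "slot t j \<longleftrightarrow> t < S \<and> j < M \<and> inc t j"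

definition V :: "vertex set" where
  "V = {x. case x of Hub j \<Rightarrow> j \<le> M | VA t j \<Rightarrow> slot t j | VB t j \<Rightarrow> slot t j | VC t j \<Rightarrow> slot t j}"

lemma V_simps [simp]:
  "Hub j \<in> V \<longleftrightarrow> j \<le> M" "VA t j \<in> V \<longleftrightarrow> slot t j" "VB t j \<in> V \<longleftrightarrow> slot t j" "VC t j \<in> V \<longleftrightarrow> slot t j"
  by (simp_all add: V_def)

definition path :: "nat \<Rightarrow> nat \<Rightarrow> vertex list" where
  "path j t = concat (map (\<lambda>t. [VA t j, VB t j, VC t j]) (filter (\<lambda>t. inc t j) [t..<S]))"

definition entry :: "nat \<Rightarrow> nat \<Rightarrow> vertex" where
  "entry j t = hd (path j t @ [Hub (Suc j)])"

text \<open>In the first phase \<open>VC t j\<close> leads on to the next slot of the same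
  \<open>j\<close>, or to the next hub; in the second, \<open>VA t j\<close> leads to any slot of
  the next time, and only these edges carry \<open>wt\<close>.\<close>

fun ew :: "vertex \<Rightarrow> vertex \<Rightarrow> ('x, 'a) ncpoly" where
  "ew (Hub j) y =
     (if j < M then if y = Hub (Suc j) then lab j else if y = entry j 0 then 1 else 0
      else if \<exists>j'. y = VC 0 j' then 1 else 0)"
| "ew (VA t j) y =
     (if y = VB t j then 1
      else if Suc t < S then (case y of VC t' j' \<Rightarrow> if t' = Suc t then nc_const (wt t j j') else 0 | _ \<Rightarrow> 0)
      else if y = Hub 0 then 1 else 0)"
| "ew (VB t j) y = (if y = VA t j \<or> y = VC t j then 1 else 0)"
| "ew (VC t j) y = (if y = VB t j \<or> y = entry j (Suc t) then 1 else 0)"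

definition hubs :: "nat set \<Rightarrow> nat \<Rightarrow> vertex list" where
  "hubs X j = concat (map (\<lambda>i. Hub i # (if i \<in> X then [] else path i 0)) [0..<j])"

fun ret :: "nat \<Rightarrow> nat list \<Rightarrow> vertex list" where
  "ret t [] = []"
| "ret t (j # js) = VC t j # VB t j # VA t j # ret (Suc t) js"

definition tour :: "nat set \<Rightarrow> nat list \<Rightarrow> vertex list" where
  "tour X js = hubs X M @ Hub M # ret 0 js"

definition exact_covers :: "nat set set" where
  "exact_covers = {X. X \<subseteq> {..<M} \<and> (\<forall>t<S. \<exists>!j. j \<in> X \<and> inc t j)}"

definition sel :: "nat set \<Rightarrow> nat \<Rightarrow> nat" where
  "sel X t = (THE j. j \<in> X \<and> inc t j)"

lemma path_simps:
  "t \<ge> S \<Longrightarrow> path j t = []"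
  "t < S \<Longrightarrow> inc t j \<Longrightarrow> path j t = VA t j # VB t j # VC t j # path j (Suc t)"
  "t < S \<Longrightarrow> \<not> inc t j \<Longrightarrow> path j t = path j (Suc t)"
  by (simp_all add: path_def upt_conv_Cons)

lemma entry_simps:
  "t \<ge> S \<Longrightarrow> entry j t = Hub (Suc j)"
  "t < S \<Longrightarrow> inc t j \<Longrightarrow> entry j t = VA t j"
  "t < S \<Longrightarrow> \<not> inc t j \<Longrightarrow> entry j t = entry j (Suc t)"
  by (simp_all add: entry_def path_simps)

lemma entry_cases:
  obtains "entry j t = Hub (Suc j)" | t' where "entry j t = VA t' j" "t \<le> t'"
proof (cases "filter (\<lambda>t. inc t j) [t..<S]")
  case (Cons t' ts)
  then have "t' \<in> set (filter (\<lambda>t. inc t j) [t..<S])" by simp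
  then have "t \<le> t'" by simp
  moreover have "entry j t = VA t' j" using Cons by (simp add: entry_def path_def)
  ultimately show ?thesis using that by blast
next
  case Nil
  then have "entry j t = Hub (Suc j)" by (simp add: entry_def path_def)
  then show ?thesis using that by blast
qed

lemma entry_neq [simp]: "entry j t \<noteq> VB t' j'" "entry j t \<noteq> VC t' j'" "VB t' j' \<noteq> entry j t" "VC t' j' \<noteq> entry j t"
proof -
  have "entry j t \<noteq> VB t' j' \<and> entry j t \<noteq> VC t' j'"
    by (rule entry_cases[of j t]) simp_all
  then show "entry j t \<noteq> VB t' j'" "entry j t \<noteq> VC t' j'" "VB t' j' \<noteq> entry j t" "VC t' j' \<noteq> entry j t"
    by auto
qed

text \<open>Every \<open>j\<close> covers some time, so its detour is not empty and cannot be
  confused with the direct edge.\<close>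

lemma entry_0:
  assumes "j < M"
  shows "entry j 0 \<noteq> Hub (Suc j)"
proof -
  obtain t where "t < S" "inc t j" using covers[OF assms] by auto
  then have "t \<in> set (filter (\<lambda>t. inc t j) [0..<S])" by simp
  then obtain t' ts where "filter (\<lambda>t. inc t j) [0..<S] = t' # ts"
    by (metis list.exhaust empty_iff empty_set)
  then show ?thesis by (simp add: entry_def path_def)
qed

lemma set_path: "x \<in> set (path j t) \<longleftrightarrow>
  (\<exists>t'. t \<le> t' \<and> t' < S \<and> inc t' j \<and> x \<in> {VA t' j, VB t' j, VC t' j})"
  by (auto simp: path_def)

lemma distinct_path: "distinct (path j t)"
proof (induction "S - t" arbitrary: t)
  case (Suc n)
  then have "t < S" "distinct (path j (Suc t))" by simp_all
  then show ?case by (cases "inc t j") (auto simp: path_simps set_path)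
qed (simp add: path_simps)

lemma hubs_simps [simp]:
  "hubs X 0 = []" "hubs X (Suc j) = hubs X j @ Hub j # (if j \<in> X then [] else path j 0)"
  by (simp_all add: hubs_def)

lemma hubs_cong: "(\<And>i. i < j \<Longrightarrow> i \<in> X \<longleftrightarrow> i \<in> Y) \<Longrightarrow> hubs X j = hubs Y j"
  by (induction j) auto

lemma set_hubs: "x \<in> set (hubs X j) \<longleftrightarrow>
  (\<exists>i<j. x = Hub i \<or> i \<notin> X \<and> x \<in> set (path i 0))"
  by (induction j) (auto simp: less_Suc_eq)

lemma distinct_hubs: "distinct (hubs X j)"
  by (induction j) (auto simp: set_hubs distinct_path set_path)

lemma set_ret: "x \<in> set (ret t js) \<longleftrightarrow>
  (\<exists>i<length js. x \<in> {VA (t + i) (js ! i), VB (t + i) (js ! i), VC (t + i) (js ! i)})"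
proof (induction t js rule: ret.induct)
  case (2 t j js)
  show ?case unfolding ret.simps list.set insert_iff 2
    by (auto simp: less_Suc_eq_0_disj)
qed simp

lemma distinct_ret: "distinct (ret t js)"
  by (induction t js rule: ret.induct) (auto simp: set_ret)

section \<open>Hamiltonian cycles with nonzero edges are tours\<close>

context
  fixes p :: "vertex \<Rightarrow> vertex" and n :: nat
  assumes perm: "p permutes V"
    and reach: "\<And>x. x \<in> V \<Longrightarrow> \<exists>k. (p ^^ k) (Hub 0) = x"
    and closed: "(p ^^ n) (Hub 0) = Hub 0" and n_pos: "n > 0"
    and edge: "\<And>x. x \<in> V \<Longrightarrow> ew x (p x) \<noteq> 0"
begin

lemma inj_p: "p x = p y \<longleftrightarrow> x = y"
  using perm by (metis permutes_inj injD)

lemma p_in_V [simp]: "p x \<in> V \<longleftrightarrow> x \<in> V"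
  using perm by (rule permutes_in_image)

text \<open>The orbit of \<open>x\<close> would stay within two vertices, but it has to return to
  \<open>Hub 0\<close>.\<close>

lemma no_two_cycle:
  assumes "x \<in> V" "p x = y" "p y = x"
  shows "x = Hub 0 \<or> y = Hub 0"
proof -
  obtain k where k: "(p ^^ k) (Hub 0) = x" using reach[OF assms(1)] by auto
  have "(p ^^ (n * m)) (Hub 0) = Hub 0" for m
    by (induction m) (simp_all add: funpow_add closed)
  \<comment> \<open>After \<open>n * k - k\<close> further steps, \<open>k\<close> full rounds are
    completed.\<close>
  moreover have "n * k = (n * k - k) + k" using n_pos by simp
  ultimately have "(p ^^ (n * k - k)) x = Hub 0"
    using k by (metis funpow_add comp_apply)
  moreover have "(p ^^ m) x \<in> {x, y}" for m
    by (induction m) (use assms in auto)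
  ultimately show ?thesis by (metis insert_iff singletonD)
qed

text \<open>Predecessor and successor of \<open>VB t j\<close> are both among its two neighbours,
  and they differ because there is no cycle of length 2 here.\<close>

lemma direction:
  assumes "slot t j"
  shows "p (VA t j) = VB t j \<and> p (VB t j) = VC t j \<or> p (VC t j) = VB t j \<and> p (VB t j) = VA t j"
proof -
  obtain x where x: "p x = VB t j" "x \<in> V"
    using assms perm by (metis V_simps(3) p_in_V permutes_surj surjD)
  have "x = VA t j \<or> x = VC t j"
    using edge[OF x(2)] x(1) by (cases x) (auto split: if_splits vertex.splits)
  moreover have "p (VB t j) = VA t j \<or> p (VB t j) = VC t j"
    using edge[of "VB t j"] assms by (auto split: if_splits)
  ultimately show ?thesis
    using x no_two_cycle[OF x(2,1)] by auto
qed

text \<open>A slot entered at \<open>VA\<close> from outside must be crossed towards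
  \<open>VC\<close>: by injectivity its \<open>VB\<close> cannot be a second predecessor of
  \<open>VA\<close>. From \<open>VC\<close> only the next stop of the same detour remains. The start
  \<open>x\<close> is arbitrary for the sake of the induction.\<close>

lemma follow_path:
  assumes "j < M" "p x = entry j t" "\<And>t' j'. x \<noteq> VB t' j'"
  shows "successively (\<lambda>x y. p x = y) (x # path j t @ [Hub (Suc j)])"
  using assms(2,3)
proof (induction "S - t" arbitrary: t x)
  case 0
  then show ?case by (simp add: path_simps entry_simps)
next
  case (Suc m)
  then have t: "t < S" "m = S - Suc t" by simp_all
  show ?case
  proof (cases "inc t j")
    case True
    then have slot: "slot t j" using t assms(1) by (simp add: slot_def)
    have x: "p x = VA t j" using Suc.prems True t by (simp add: entry_simps)
    have "p (VB t j) \<noteq> VA t j" using x Suc.prems(2) by (metis inj_p)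
    then have AB: "p (VA t j) = VB t j" "p (VB t j) = VC t j" using direction[OF slot] by auto
    then have "p (VC t j) \<noteq> VB t j" by (metis inj_p vertex.distinct(9))
    then have "p (VC t j) = entry j (Suc t)"
      using edge[of "VC t j"] slot by (auto split: if_splits)
    from Suc.hyps(1)[OF t(2) this] show ?thesis
      using x AB True t by (simp add: path_simps)
  next
    case False
    then show ?thesis
      using Suc.hyps(1)[OF t(2), of x] Suc.prems t by (simp add: path_simps entry_simps)
  qed
qed

text \<open>The mirror image of \<open>follow_path\<close>: entry at \<open>VC\<close> forces the
  way to \<open>VA\<close>, from where the time increases by one.\<close>

lemma follow_ret:
  assumes "slot t j" "p x = VC t j" "\<And>t' j'. x \<noteq> VB t' j'"
  shows "\<exists>js. length js = S - t \<and> successively (\<lambda>x y. p x = y) (x # ret t js @ [Hub 0])"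
  using assms
proof (induction "S - t" arbitrary: t x j)
  case 0
  then show ?case by (simp add: slot_def)
next
  case (Suc m)
  have "p (VB t j) \<noteq> VC t j" using Suc.prems(2,3) by (metis inj_p)
  then have CB: "p (VC t j) = VB t j" "p (VB t j) = VA t j" using direction[OF Suc.prems(1)] by auto
  then have A: "p (VA t j) \<noteq> VB t j" by (metis inj_p vertex.distinct(9))
  have E: "ew (VA t j) (p (VA t j)) \<noteq> 0" using edge[of "VA t j"] Suc.prems(1) by simp
  show ?case
  proof (cases "Suc t < S")
    case True
    then obtain j' where j': "p (VA t j) = VC (Suc t) j'"
      using E A by (auto split: vertex.splits if_splits)
    then have "slot (Suc t) j'"
      using Suc.prems(1) by (metis V_simps(2,4) p_in_V)
    moreover have "m = S - Suc t" using Suc.hyps(2) by simp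
    ultimately obtain js where
      "length js = S - Suc t" "successively (\<lambda>x y. p x = y) (VA t j # ret (Suc t) js @ [Hub 0])"
      using Suc.hyps(1)[of "Suc t" j' "VA t j"] j' by auto
    then show ?thesis
      using CB Suc.prems True by (intro exI[of _ "j # js"]) simp
  next
    case False
    then have "p (VA t j) = Hub 0"
      using E A by (auto split: if_splits)
    moreover have "S - t = 1" using Suc.prems(1) False unfolding slot_def by linarith
    ultimately show ?thesis
      using CB Suc.prems by (intro exI[of _ "[j]"]) simp
  qed
qed

lemma follow_hubs:
  assumes "j \<le> M"
  shows "\<exists>X\<subseteq>{..<j}. successively (\<lambda>x y. p x = y) (hubs X j @ [Hub j])"
  using assms
proof (induction j)
  case (Suc j)
  then obtain X where X: "X \<subseteq> {..<j}" "successively (\<lambda>x y. p x = y) (hubs X j @ [Hub j])"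
    by auto
  have E: "ew (Hub j) (p (Hub j)) \<noteq> 0" using edge[of "Hub j"] Suc.prems by simp
  show ?case
  proof (cases "p (Hub j) = Hub (Suc j)")
    case True
    have "hubs (insert j X) j = hubs X j" by (rule hubs_cong) auto
    then show ?thesis
      using X True by (intro exI[of _ "insert j X"]) (auto simp: successively_append_iff)
  next
    case False
    then have "p (Hub j) = entry j 0"
      using E Suc.prems by (auto split: if_splits)
    then have "successively (\<lambda>x y. p x = y) (Hub j # path j 0 @ [Hub (Suc j)])"
      using Suc.prems by (intro follow_path) auto
    from successively_glue[OF X(2) this] show ?thesis
      using X(1) by (intro exI[of _ X]) auto
  qed
qed auto

lemma follow_tour:
  "\<exists>X js. X \<subseteq> {..<M} \<and> length js = S \<and> successively (\<lambda>x y. p x = y) (tour X js @ [Hub 0])"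
proof -
  obtain X where X: "X \<subseteq> {..<M}" "successively (\<lambda>x y. p x = y) (hubs X M @ [Hub M])"
    using follow_hubs[of M] by auto
  have "ew (Hub M) (p (Hub M)) \<noteq> 0" using edge[of "Hub M"] by simp
  then obtain j where j: "p (Hub M) = VC 0 j" by (auto split: if_splits)
  then have "slot 0 j" by (metis V_simps(1,4) p_in_V order_refl)
  from follow_ret[OF this j] obtain js where
    js: "length js = S" "successively (\<lambda>x y. p x = y) (Hub M # ret 0 js @ [Hub 0])" by auto
  from successively_glue[OF X(2) js(2)] show ?thesis
    using X js unfolding tour_def by auto
qed

end

lemma hd_hubs: "hd (hubs X j @ Hub j # ys) = Hub 0"
  by (induction j arbitrary: ys) simp_all

lemma hd_tour: "tour X js = Hub 0 # tl (tour X js)" "Hub 0 \<notin> set (tl (tour X js))"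
proof -
  have "tour X js \<noteq> []" by (simp add: tour_def)
  moreover have "hd (tour X js) = Hub 0"
    by (simp add: tour_def hd_hubs)
  ultimately show 1: "tour X js = Hub 0 # tl (tour X js)" by (metis list.collapse)
  \<comment> \<open>For arbitrary \<open>js\<close> the two phases may share slots, so distinctness
    is claimed only for the hubs.\<close>
  have "distinct (filter (\<lambda>x. \<exists>j. x = Hub j) (tour X js))"
    by (auto simp: tour_def distinct_hubs set_hubs distinct_ret set_ret set_path)
  then show "Hub 0 \<notin> set (tl (tour X js))"
    by (subst (asm) 1) simp
qed

lemma sel_eq: "X \<in> exact_covers \<Longrightarrow> t < S \<Longrightarrow> j = sel X t \<longleftrightarrow> j \<in> X \<and> inc t j"
  using theI'[of "\<lambda>j. j \<in> X \<and> inc t j"] unfolding sel_def exact_covers_def by blast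

lemma tour_ham:
  assumes "X \<in> exact_covers"
  shows "tour X (map (sel X) [0..<S]) \<in> ham_lists V (Hub 0)"
proof -
  let ?js = "map (sel X) [0..<S]"
  have X: "X \<subseteq> {..<M}" using assms by (simp add: exact_covers_def)
  have hubs: "x \<in> set (hubs X M) \<longleftrightarrow> (\<exists>i<M. x = Hub i) \<or>
      (\<exists>t j. slot t j \<and> j \<notin> X \<and> x \<in> {VA t j, VB t j, VC t j})" for x
    by (auto simp: set_hubs set_path slot_def)
  have ret: "x \<in> set (ret 0 ?js) \<longleftrightarrow>
      (\<exists>t j. slot t j \<and> j \<in> X \<and> x \<in> {VA t j, VB t j, VC t j})" for x
  proof -
    have "x \<in> set (ret 0 ?js) \<longleftrightarrow> (\<exists>t<S. \<exists>j. j = sel X t \<and> x \<in> {VA t j, VB t j, VC t j})"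
      by (auto simp: set_ret)
    also have "\<dots> \<longleftrightarrow> (\<exists>t<S. \<exists>j. (j \<in> X \<and> inc t j) \<and> x \<in> {VA t j, VB t j, VC t j})"
      using sel_eq[OF assms] by metis
    finally show ?thesis using X by (auto simp: slot_def)
  qed
  have "set (tour X ?js) = V"
  proof (rule set_eqI)
    fix x show "x \<in> set (tour X ?js) \<longleftrightarrow> x \<in> V"
      by (cases x) (auto simp: tour_def hubs ret)
  qed
  moreover have "distinct (tour X ?js)"
    using hubs ret by (auto simp: tour_def distinct_hubs distinct_ret)
  ultimately show ?thesis
    using hd_tour(1)[of X ?js] unfolding ham_lists_def by (metis (mono_tags, lifting) list.sel(1) list.distinct(1) mem_Collect_eq)
qed

lemma V_subset: "V \<subseteq> Hub ` {..M} \<union> (\<lambda>(t, j). VA t j) ` ({..<S} \<times> {..<M}) \<union>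
    (\<lambda>(t, j). VB t j) ` ({..<S} \<times> {..<M}) \<union> (\<lambda>(t, j). VC t j) ` ({..<S} \<times> {..<M})"
proof
  fix x assume "x \<in> V"
  then show "x \<in> Hub ` {..M} \<union> (\<lambda>(t, j). VA t j) ` ({..<S} \<times> {..<M}) \<union>
    (\<lambda>(t, j). VB t j) ` ({..<S} \<times> {..<M}) \<union> (\<lambda>(t, j). VC t j) ` ({..<S} \<times> {..<M})"
    by (cases x) (auto simp: slot_def)
qed

lemma finite_V: "finite V"
  using V_subset by (rule finite_subset) auto

lemma card_V: "card V \<le> Suc M + 3 * (S * M)"
proof -
  let ?T = "{..<S} \<times> {..<M}"
  let ?f = "\<lambda>C. (\<lambda>(t, j). C t j) ` ?T"
  have "card V \<le> card (Hub ` {..M} \<union> ?f VA \<union> ?f VB \<union> ?f VC)"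
    using V_subset by (rule card_mono[rotated]) auto
  also have "\<dots> \<le> card (Hub ` {..M}) + card (?f VA) + card (?f VB) + card (?f VC)"
    by (meson card_Un_le add_le_mono1 order_trans)
  also have "\<dots> \<le> card {..M} + card ?T + card ?T + card ?T"
    by (intro add_mono card_image_le) auto
  finally show ?thesis by simp
qed

text \<open>A zero factor would kill the product, so the cycle has nonzero edges and is the tour of
  some \<open>X\<close> and \<open>js\<close>. That \<open>X\<close> is an exact cover follows
  because the list contains every vertex exactly once.\<close>

lemma nonzero_ham_is_tour:
  assumes xs: "xs \<in> ham_lists V (Hub 0)" and "walk ew (xs @ [Hub 0]) \<noteq> 0"
  shows "\<exists>X\<in>exact_covers. xs = tour X (map (sel X) [0..<S])"
proof -
  obtain p where p: "p permutes V" "\<And>k. k < length xs \<Longrightarrow> (p ^^ k) (Hub 0) = xs ! k"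
    "(p ^^ length xs) (Hub 0) = Hub 0"
    using ham_list_permutation[OF xs] by blast
  have x: "distinct xs" "set xs = V" "xs \<noteq> []" "xs ! 0 = Hub 0"
    using xs by (auto simp: ham_lists_def hd_conv_nth)
  have reach: "\<exists>k<length xs. (p ^^ k) (Hub 0) = y" if "y \<in> V" for y
    using that p(2) x(2) by (metis in_set_conv_nth)
  have edge: "ew y (p y) \<noteq> 0" if y: "y \<in> V" for y
  proof -
    obtain k where k: "k < length xs" "(p ^^ k) (Hub 0) = y"
      using reach[OF y] by auto
    have "(xs @ [Hub 0]) ! Suc k = (p ^^ Suc k) (Hub 0)"
      using k(1) p(2)[of "Suc k"] p(3) by (cases "Suc k = length xs") (auto simp only: nth_append_length, simp add: nth_append)
    then have "(xs @ [Hub 0]) ! Suc k = p y" using k(2) by simp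
    moreover have "(xs @ [Hub 0]) ! k = y"
      using k p(2)[of k] by (simp add: nth_append)
    moreover have "ew ((xs @ [Hub 0]) ! k) ((xs @ [Hub 0]) ! Suc k) \<noteq> 0"
    proof
      assume "ew ((xs @ [Hub 0]) ! k) ((xs @ [Hub 0]) ! Suc k) = 0"
      then have "0 \<in> set (map (\<lambda>k. ew ((xs @ [Hub 0]) ! k) ((xs @ [Hub 0]) ! Suc k)) [0..<length (xs @ [Hub 0]) - 1])"
        using k(1) by (auto simp: image_iff intro!: bexI[of _ k])
      then have "walk ew (xs @ [Hub 0]) = 0"
        unfolding walk_nth by (rule prod_list_zero)
      then show False using assms(2) by simp
    qed
    ultimately show ?thesis by simp
  qed
  obtain X js where X: "X \<subseteq> {..<M}" "length js = S"
      "successively (\<lambda>x y. p x = y) (tour X js @ [Hub 0])"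
    using follow_tour[OF p(1) _ p(3) _ edge] reach x(3) by blast
  have xt: "xs = tour X js"
    using ham_list_unique[OF _ hd_tour(2) x(1,3) p(2,3)] X(3) hd_tour(1)[of X js] by (metis append_Cons)
  \<comment> \<open>A slot \<open>(t, j)\<close> is met in the first phase exactly if
    \<open>j\<close> is not in \<open>X\<close>, and in the second exactly if
    \<open>j = js ! t\<close>. As \<open>VC t j\<close> occurs exactly once, one and only one of the
    two holds.\<close>
  have sel: "j \<in> X \<and> inc t j \<longleftrightarrow> j = js ! t" if t: "t < S" for t j
  proof -
    have s: "VC t (js ! t) \<in> set xs"
      using t X(2) by (auto simp: xt tour_def set_ret)
    then have s': "slot t (js ! t)" using x(2) by simp
    have *: "VC t j \<in> set (hubs X M) \<longleftrightarrow> j \<notin> X" if "slot t j" for j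
      using that by (auto simp: set_hubs set_path slot_def)
    have **: "VC t j \<in> set (ret 0 js) \<longleftrightarrow> j = js ! t" for j
      using t X(2) by (auto simp: set_ret)
    have "js ! t \<in> X"
      using x(1) *[OF s'] **[of "js ! t"] by (auto simp: xt tour_def)
    moreover have "j = js ! t" if "j \<in> X" "inc t j"
    proof -
      have "slot t j" using that X(1) t by (auto simp: slot_def)
      then have "VC t j \<in> set xs" "VC t j \<notin> set (hubs X M)" using * that x(2) by auto
      then have "VC t j \<in> set (ret 0 js)" by (auto simp: xt tour_def)
      then show ?thesis using ** by simp
    qed
    ultimately show ?thesis using s' by (auto simp: slot_def)
  qed
  then have "X \<in> exact_covers"
    using X(1) by (auto simp: exact_covers_def)
  moreover have "map (sel X) [0..<S] = js"
    using X(2) sel sel_eq[OF calculation] by (intro nth_equalityI) auto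
  ultimately show ?thesis using xt by blast
qed

text \<open>\<open>Hub M\<close> separates the phases, and \<open>j\<close> is outside
  \<open>X\<close> exactly if its slots, of which there is at least one, lie in the first
  phase.\<close>

lemma tour_inj: "inj_on (\<lambda>X. tour X (map (sel X) [0..<S])) exact_covers"
proof (rule inj_onI)
  fix X Y assume XY: "X \<in> exact_covers" "Y \<in> exact_covers"
    and eq: "tour X (map (sel X) [0..<S]) = tour Y (map (sel Y) [0..<S])"
  have nin: "Hub M \<notin> set (hubs Z M)" for Z by (auto simp: set_hubs set_path)
  have "hubs X M = hubs Y M"
    using eq nin[of X] nin[of Y] unfolding tour_def
    by (metis append_Cons_eq_iff set_ret list.set_intros(1) in_set_conv_decomp insert_iff vertex.distinct(1,3,5) singletonD)
  then have *: "VC t j \<in> set (hubs X M) \<longleftrightarrow> VC t j \<in> set (hubs Y M)" for t j by simp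
  have "j \<in> X \<longleftrightarrow> j \<in> Y" if j: "j < M" for j
  proof -
    obtain t where "t < S" "inc t j" using covers[OF j] by auto
    then show ?thesis using *[of t j] j by (auto simp: set_hubs set_path)
  qed
  then show "X = Y" using XY by (auto simp: exact_covers_def)
qed

section \<open>The weight of a tour\<close>

lemma walk_path:
  assumes "ew x (entry j t) = 1"
  shows "walk ew (x # path j t @ [Hub (Suc j)]) = 1"
  using assms
proof (induction "S - t" arbitrary: t x)
  case 0
  then show ?case by (simp add: path_simps entry_simps)
next
  case (Suc m)
  then have t: "t < S" "m = S - Suc t" by simp_all
  show ?case
  proof (cases "inc t j")
    case True
    then show ?thesis
      using Suc.hyps(1)[OF t(2), of "VC t j"] Suc.prems t by (simp add: path_simps entry_simps)
  next
    case False
    then show ?thesis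
      using Suc.hyps(1)[OF t(2), of x] Suc.prems t by (simp add: path_simps entry_simps)
  qed
qed

lemma walk_hubs:
  assumes "j \<le> M"
  shows "walk ew (hubs X j @ [Hub j]) = prod_list (map (\<lambda>i. if i \<in> X then lab i else 1) [0..<j])"
  using assms
proof (induction j)
  case (Suc j)
  have "walk ew (Hub j # (if j \<in> X then [] else path j 0) @ [Hub (Suc j)]) = (if j \<in> X then lab j else 1)"
    using Suc.prems walk_path[of "Hub j" j 0] entry_0[of j] by auto
  then show ?case
    using Suc walk_append[of ew "hubs X j" "Hub j" "(if j \<in> X then [] else path j 0) @ [Hub (Suc j)]"] by simp
qed simp

lemma walk_ret:
  assumes "t + length js = S" "js \<noteq> []"
  shows "walk ew (x # ret t js @ [Hub 0]) =
    ew x (VC t (hd js)) * nc_const (\<Prod>i<length js - 1. wt (t + i) (js ! i) (js ! Suc i))"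
  using assms
proof (induction js arbitrary: t x)
  case (Cons j js)
  show ?case
  proof (cases js)
    case Nil
    then show ?thesis using Cons.prems by simp
  next
    case (Cons j' js')
    have "walk ew (VA t j # ret (Suc t) js @ [Hub 0]) =
        nc_const (wt t j j') * nc_const (\<Prod>i<length js - 1. wt (Suc t + i) (js ! i) (js ! Suc i))"
      using Cons.IH[of "Suc t" "VA t j"] Cons.prems Cons by simp
    also have "\<dots> = nc_const (\<Prod>i<length (j # js) - 1. wt (t + i) ((j # js) ! i) ((j # js) ! Suc i))"
      using Cons by (simp add: prod.lessThan_Suc_shift nc_const_mult del: prod.lessThan_Suc)
    finally show ?thesis by simp
  qed
qed simp

lemma walk_tour:
  "walk ew (tour X (map (sel X) [0..<S]) @ [Hub 0]) =
    prod_list (map (\<lambda>i. if i \<in> X then lab i else 1) [0..<M]) *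
    nc_const (\<Prod>t<S - 1. wt t (sel X t) (sel X (Suc t)))"
proof -
  let ?js = "map (sel X) [0..<S]"
  have "walk ew (tour X ?js @ [Hub 0]) = walk ew (hubs X M @ [Hub M]) * walk ew (Hub M # ret 0 ?js @ [Hub 0])"
    using walk_append[of ew "hubs X M" "Hub M" "ret 0 ?js @ [Hub 0]"] by (simp add: tour_def)
  also have "walk ew (Hub M # ret 0 ?js @ [Hub 0]) =
      nc_const (\<Prod>t<S - 1. wt t (?js ! t) (?js ! Suc t))"
    using walk_ret[of 0 ?js "Hub M"] S_pos by simp
  also have "(\<Prod>t<S - 1. wt t (?js ! t) (?js ! Suc t)) = (\<Prod>t<S - 1. wt t (sel X t) (sel X (Suc t)))"
    by (rule prod.cong) auto
  finally show ?thesis by (simp add: walk_hubs)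
qed

lemma exact_cover_projection:
  "projection
     (\<Sum>X\<in>exact_covers. prod_list (map (\<lambda>i. if i \<in> X then lab i else 1) [0..<M]) *
        nc_const (\<Prod>t<S - 1. wt t (sel X t) (sel X (Suc t))))
     (HC (card V))"
proof -
  let ?tour = "\<lambda>X. tour X (map (sel X) [0..<S])"
  have c: "nc_const c \<in> range nc_var \<union> range nc_const" "1 \<in> range nc_var \<union> range nc_const"
    "0 \<in> range nc_var \<union> range nc_const" for c :: 'a
    by (blast, metis UnI2 nc_const_1 rangeI, metis UnI2 nc_const_0 rangeI)
  have ew: "ew x y \<in> range nc_var \<union> range nc_const" for x y
    by (cases x; cases y) (use lab c in \<open>simp_all only: ew.simps vertex.case split: if_splits\<close>, auto)
  have "(\<Sum>xs\<in>ham_lists V (Hub 0). walk ew (xs @ [Hub 0])) =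
      (\<Sum>xs\<in>?tour ` exact_covers. walk ew (xs @ [Hub 0]))"
    by (rule sum.mono_neutral_right) (use tour_ham nonzero_ham_is_tour finite_V in auto)
  also have "\<dots> = (\<Sum>X\<in>exact_covers. walk ew (?tour X @ [Hub 0]))"
    by (simp add: sum.reindex[OF tour_inj])
  finally show ?thesis
    using ham_sum_projection[where w=ew, OF finite_V _ ew, of "Hub 0"] by (simp add: walk_tour)
qed

end

section \<open>Binary constraint satisfaction\<close>

lemma prod_list_single:
  "i < n \<Longrightarrow> prod_list (map (\<lambda>k. if k = i then c else 1) [0..<n]) = (c :: 'b::monoid_mult)"
proof (induction n)
  case (Suc n)
  have "prod_list (map (\<lambda>k. if k = i then c else 1) [0..<m]) = 1" if "m \<le> i" for m
    using that by (induction m) auto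
  then show ?case using Suc by (cases "i = n") auto
qed simp

text \<open>In each block only the chosen factor can differ from 1. This contracts the labels of all
  hubs to one label per column, in the same order.\<close>

lemma prod_list_blocks:
  fixes f :: "nat \<Rightarrow> nat \<Rightarrow> 'b::monoid_mult"
  assumes "\<And>k. k < K \<Longrightarrow> g k < N"
  shows "prod_list (map (\<lambda>i. if i mod N = g (i div N) then f (i div N) (i mod N) else 1) [0..<K * N]) =
    prod_list (map (\<lambda>k. f k (g k)) [0..<K])"
  using assms
proof (induction K)
  case (Suc K)
  let ?F = "\<lambda>i. if i mod N = g (i div N) then f (i div N) (i mod N) else 1"
  have upt: "[0..<Suc K * N] = [0..<K * N] @ map (\<lambda>i. i + K * N) [0..<N]"
    unfolding map_add_upt by (metis add.commute le0 mult_Suc upt_add_eq_append)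
  have block: "map (?F \<circ> (\<lambda>i. i + K * N)) [0..<N] = map (\<lambda>i. if i = g K then f K (g K) else 1) [0..<N]"
    by (intro map_cong) auto
  show ?case
    unfolding upt map_append map_map prod_list.append block
    using Suc by (simp add: prod_list_single)
qed simp

text \<open>\<open>Suc Q\<close> pairs of times have \<open>2 * Q + 1\<close> steps between them; a
  step from an odd time joins unrelated pairs and counts 1.\<close>

lemma prod_even_steps:
  "(\<Prod>t<Suc (2 * Q). if even t then G (t div 2) else 1) = (\<Prod>q<Suc Q. G q)"
  for Q :: nat and G :: "nat \<Rightarrow> 'b::comm_monoid_mult"
  by (induction Q) simp_all

lemma prod_div_mod:
  fixes G :: "nat \<Rightarrow> nat \<Rightarrow> 'b::comm_monoid_mult"
  shows "(\<Prod>q<n * K. G (q div K) (q mod K)) = (\<Prod>a<n. \<Prod>b<K. G a b)"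
proof -
  have "(\<Prod>a<n. \<Prod>b<K. G a b) = (\<Prod>(a, b)\<in>{..<n} \<times> {..<K}. G a b)"
    by (simp add: prod.cartesian_product)
  also have "\<dots> = (\<Prod>q<n * K. G (q div K) (q mod K))"
  proof (rule prod.reindex_bij_witness[of _ "\<lambda>q. (q div K, q mod K)" "\<lambda>(a, b). a * K + b"])
    fix q assume q: "q \<in> {..<n * K}"
    then have "K > 0" by (cases K) auto
    then show "(q div K, q mod K) \<in> {..<n} \<times> {..<K}"
      using q by (auto simp: less_mult_imp_div_less)
  next
    fix p assume "p \<in> {..<n} \<times> {..<K}"
    then obtain a b where p: "p = (a, b)" "a < n" "b < K" by auto
    have "a * K + b < Suc a * K" using p by simp
    also have "\<dots> \<le> n * K" using p by (intro mult_right_mono) auto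
    finally show "(case p of (a, b) \<Rightarrow> a * K + b) \<in> {..<n * K}" using p by simp
  qed auto
  finally show ?thesis ..
qed

text \<open>
  The pairs of columns \<open>(a, b)\<close> are enumerated as \<open>q = a * K + b\<close>; time \<open>2 * q\<close> visits column \<open>a\<close> and
  time \<open>2 * q + 1\<close> column \<open>b\<close>, so that every pair of columns meets on some edge of the way back.
  Element \<open>j\<close> of the exact cover says that column \<open>j div N\<close> takes the value number \<open>j mod N\<close>.
\<close>

lemma csp_projection:
  fixes W :: "nat \<Rightarrow> nat \<Rightarrow> 'v \<Rightarrow> 'v \<Rightarrow> 'a::comm_semiring_1" and L :: "nat \<Rightarrow> 'v \<Rightarrow> ('x, 'a) ncpoly"
  assumes Dom: "finite Dom" and K: "K > 0"
    and L: "\<And>k v. L k v \<in> range nc_var \<union> range nc_const"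
  shows "\<exists>n\<ge>1. n \<le> Suc (K * card Dom) + 3 * (2 * (K * K) * (K * card Dom)) \<and>
    projection
      (\<Sum>xs | set xs \<subseteq> Dom \<and> length xs = K.
         nc_const (\<Prod>a<K. \<Prod>b<K. W a b (xs ! a) (xs ! b)) * prod_list (map (\<lambda>k. L k (xs ! k)) [0..<K]))
      (HC n)"
proof -
  define N where "N = card Dom"
  obtain e where e: "bij_betw e {..<N} Dom"
    using ex_bij_betw_nat_finite[OF Dom] by (auto simp: N_def lessThan_atLeast0)
  define idx where "idx = inv_into {..<N} e"
  have idx: "idx v < N" "e (idx v) = v" if "v \<in> Dom" for v
    using e that bij_betw_inv_into[OF e] unfolding idx_def
    by (auto simp: bij_betw_def f_inv_into_f)
  have idx_e: "idx (e i) = i" "e i \<in> Dom" if "i < N" for i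
    using e that unfolding idx_def by (auto simp: bij_betw_def)
  define col where "col t = (if even t then t div 2 div K else t div 2 mod K)" for t
  define inc where "inc t j \<longleftrightarrow> j div N = col t" for t j
  define lab where "lab j = L (j div N) (e (j mod N))" for j
  define wt where "wt t j j' = (if even t then W (col t) (col (Suc t)) (e (j mod N)) (e (j' mod N)) else 1)" for t j j'
  let ?S = "2 * (K * K)"
  have col_lt: "col t < K" if "t < ?S" for t
  proof -
    have "t div 2 < K * K" using that by auto
    then show ?thesis using K by (auto simp: col_def less_mult_imp_div_less)
  qed
  \<comment> \<open>The witness is the first time of the pair \<open>(k, 0)\<close>.\<close>
  have col_ex: "\<exists>t<?S. col t = k" if "k < K" for k
    using that K by (intro exI[of _ "2 * (k * K)"]) (auto simp: col_def)
  interpret exact_cover "K * N" ?S inc lab wt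
  proof
    show "\<exists>t<?S. inc t j" if "j < K * N" for j
      using col_ex[of "j div N"] that by (auto simp: inc_def less_mult_imp_div_less)
  qed (use K L in \<open>auto simp: lab_def\<close>)
  \<comment> \<open>Every column is visited at some time, so covering each time exactly once means
    one value per column.\<close>
  have covers: "exact_covers = {X. X \<subseteq> {..<K * N} \<and> (\<forall>k<K. \<exists>!j. j \<in> X \<and> j div N = k)}"
  proof -
    have "(\<forall>t<?S. P (col t)) \<longleftrightarrow> (\<forall>k<K. P k)" for P
      using col_lt col_ex by metis
    from this[of "\<lambda>k. \<exists>!j. j \<in> X \<and> j div N = k" for X] show ?thesis
      unfolding exact_covers_def inc_def by simp
  qed
  define code where "code xs = (\<lambda>k. k * N + idx (xs ! k)) ` {..<K}" for xs
  let ?Lists = "{xs. set xs \<subseteq> Dom \<and> length xs = K}"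
  have nth: "xs ! k \<in> Dom" if "xs \<in> ?Lists" "k < K" for xs k
    using that by auto
  have div_mod: "(k * N + idx v) div N = k" "(k * N + idx v) mod N = idx v" if "v \<in> Dom" for k v
    using idx(1)[OF that] by simp_all
  have in_code: "j \<in> code xs \<longleftrightarrow> j < K * N \<and> j mod N = idx (xs ! (j div N))" if xs: "xs \<in> ?Lists" for j xs
  proof
    assume "j \<in> code xs"
    then obtain k where k: "k < K" "j = k * N + idx (xs ! k)" by (auto simp: code_def)
    have "j < Suc k * N" using k idx(1)[OF nth[OF xs k(1)]] by simp
    also have "\<dots> \<le> K * N" using k by (intro mult_right_mono) auto
    finally show "j < K * N \<and> j mod N = idx (xs ! (j div N))"
      using k div_mod[OF nth[OF xs k(1)]] by simp
  next
    assume j: "j < K * N \<and> j mod N = idx (xs ! (j div N))"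
    then have "j div N < K" by (simp add: less_mult_imp_div_less)
    moreover have "j = j div N * N + idx (xs ! (j div N))" using j by (metis div_mult_mod_eq)
    ultimately show "j \<in> code xs" by (auto simp: code_def)
  qed
  have code_iff: "j \<in> code xs \<and> j div N = k \<longleftrightarrow> j = k * N + idx (xs ! k)" if xs: "xs \<in> ?Lists" and "k < K" for j k xs
    using that div_mod[OF nth[OF xs]] by (auto simp: code_def)
  have code_covers: "code xs \<in> exact_covers" if xs: "xs \<in> ?Lists" for xs
    unfolding covers using in_code[OF xs] code_iff[OF xs] by auto
  have sel: "sel (code xs) t = col t * N + idx (xs ! col t)" if xs: "xs \<in> ?Lists" and "t < ?S" for xs t
    using sel_eq[OF code_covers[OF xs] that(2)] code_iff[OF xs col_lt[OF that(2)]] unfolding inc_def by metis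
  have bij: "bij_betw code ?Lists exact_covers"
  proof (rule bij_betwI')
    fix xs ys assume xs: "xs \<in> ?Lists" and ys: "ys \<in> ?Lists"
    show "code xs = code ys \<longleftrightarrow> xs = ys"
    proof
      assume eq: "code xs = code ys"
      show "xs = ys"
      proof (rule nth_equalityI)
        fix k assume "k < length xs"
        then have k: "k < K" using xs by simp
        have "idx (xs ! k) = idx (ys ! k)"
          using code_iff[OF xs k, of "k * N + idx (xs ! k)"] code_iff[OF ys k, of "k * N + idx (xs ! k)"] eq by simp
        then show "xs ! k = ys ! k" using idx(2) nth[OF xs k] nth[OF ys k] by metis
      qed (use xs ys in simp)
    qed simp
  next
    fix X assume "X \<in> exact_covers"
    then have X: "X \<subseteq> {..<K * N}" "\<forall>k<K. \<exists>!j. j \<in> X \<and> j div N = k" by (auto simp: covers)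
    then obtain f where f: "\<And>k j. k < K \<Longrightarrow> j \<in> X \<and> j div N = k \<longleftrightarrow> j = f k"
      by metis
    define xs where "xs = map (\<lambda>k. e (f k mod N)) [0..<K]"
    \<comment> \<open>The member \<open>f k\<close> of \<open>X\<close> lies below
      \<open>K * N\<close>, which excludes \<open>N = 0\<close>.\<close>
    have N: "f k mod N < N" if "k < K" for k
      using f[OF that, of "f k"] X(1) by (metis lessThan_iff mod_less_divisor mult_0_right not_less_zero subsetD gr0I)
    have xs: "xs \<in> ?Lists" using idx_e(2) N by (auto simp: xs_def)
    have "j \<in> X \<longleftrightarrow> j \<in> code xs" for j
    proof (cases "j < K * N")
      case True
      then have k: "j div N < K" by (simp add: less_mult_imp_div_less)
      have "j \<in> X \<longleftrightarrow> j = f (j div N)" using f[OF k, of j] by simp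
      also have "\<dots> \<longleftrightarrow> j mod N = f (j div N) mod N"
        using f[OF k, of "f (j div N)"] by (metis div_mult_mod_eq)
      also have "\<dots> \<longleftrightarrow> j mod N = idx (xs ! (j div N))"
        using k N[OF k] by (simp add: xs_def idx_e(1))
      finally show ?thesis using in_code[OF xs] True by simp
    qed (use X in_code[OF xs] in auto)
    then show "\<exists>xs\<in>?Lists. X = code xs" using xs by blast
  qed (rule code_covers)
  have labels: "prod_list (map (\<lambda>i. if i \<in> code xs then lab i else 1) [0..<K * N]) =
      prod_list (map (\<lambda>k. L k (xs ! k)) [0..<K])" if xs: "xs \<in> ?Lists" for xs
  proof -
    have "map (\<lambda>i. if i \<in> code xs then lab i else 1) [0..<K * N] =
        map (\<lambda>i. if i mod N = idx (xs ! (i div N)) then L (i div N) (e (i mod N)) else 1) [0..<K * N]"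
      by (intro map_cong refl) (simp add: in_code[OF xs] lab_def)
    also have "prod_list \<dots> = prod_list (map (\<lambda>k. L k (e (idx (xs ! k)))) [0..<K])"
      using idx(1)[OF nth[OF xs]] by (intro prod_list_blocks) auto
    also have "\<dots> = prod_list (map (\<lambda>k. L k (xs ! k)) [0..<K])"
      using idx(2)[OF nth[OF xs]] by (intro arg_cong[where f=prod_list] map_cong) auto
    finally show ?thesis .
  qed
  have weights: "(\<Prod>t<?S - 1. wt t (sel (code xs) t) (sel (code xs) (Suc t))) =
      (\<Prod>a<K. \<Prod>b<K. W a b (xs ! a) (xs ! b))" if xs: "xs \<in> ?Lists" for xs
  proof -
    let ?G = "\<lambda>a b. W a b (xs ! a) (xs ! b)"
    have "wt t (sel (code xs) t) (sel (code xs) (Suc t)) =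
        (if even t then ?G (t div 2 div K) (t div 2 mod K) else 1)" if "t < ?S - 1" for t
    proof -
      have "t < ?S" "Suc t < ?S" using that by auto
      note t = sel[OF xs this(1)] sel[OF xs this(2)] col_lt[OF this(1)] col_lt[OF this(2)]
      show ?thesis
        using t(3,4) nth[OF xs t(3)] nth[OF xs t(4)]
        by (auto simp: wt_def t(1,2) idx) (auto simp: col_def)
    qed
    then have "(\<Prod>t<?S - 1. wt t (sel (code xs) t) (sel (code xs) (Suc t))) =
        (\<Prod>t<?S - 1. if even t then ?G (t div 2 div K) (t div 2 mod K) else 1)"
      by (intro prod.cong) auto
    also have "\<dots> = (\<Prod>q<K * K. ?G (q div K) (q mod K))"
    proof -
      obtain Q where "K * K = Suc Q" using K by (metis gr0_conv_Suc nat_0_less_mult_iff)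
      then show ?thesis
        using prod_even_steps[of "\<lambda>q. ?G (q div K) (q mod K)" Q] by simp
    qed
    also have "\<dots> = (\<Prod>a<K. \<Prod>b<K. ?G a b)"
      by (rule prod_div_mod)
    finally show ?thesis .
  qed
  have "(\<Sum>xs\<in>?Lists. nc_const (\<Prod>a<K. \<Prod>b<K. W a b (xs ! a) (xs ! b)) * prod_list (map (\<lambda>k. L k (xs ! k)) [0..<K])) =
      (\<Sum>xs\<in>?Lists. prod_list (map (\<lambda>i. if i \<in> code xs then lab i else 1) [0..<K * N]) *
        nc_const (\<Prod>t<?S - 1. wt t (sel (code xs) t) (sel (code xs) (Suc t))))"
    by (intro sum.cong refl) (simp only: labels weights nc_const_commute)
  also have "\<dots> = (\<Sum>X\<in>exact_covers. prod_list (map (\<lambda>i. if i \<in> X then lab i else 1) [0..<K * N]) *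
        nc_const (\<Prod>t<?S - 1. wt t (sel X t) (sel X (Suc t))))"
    by (rule sum.reindex_bij_betw[OF bij])
  finally have "projection (\<Sum>xs\<in>?Lists. nc_const (\<Prod>a<K. \<Prod>b<K. W a b (xs ! a) (xs ! b)) *
      prod_list (map (\<lambda>k. L k (xs ! k)) [0..<K])) (HC (card V))"
    using exact_cover_projection by simp
  moreover have "card V \<ge> 1"
    using finite_V V_simps(1)[of 0] by (metis One_nat_def Suc_leI card_gt_0_iff empty_iff zero_le)
  ultimately show ?thesis using card_V unfolding N_def by blast
qed

section \<open>Weighted parse trees\<close>

lemma prod_lessThan_add:
  "(\<Prod>b<m + n. f b) = (\<Prod>b<m. f b) * (\<Prod>b<n. f (m + b))" for f :: "nat \<Rightarrow> 'b::comm_monoid_mult"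
  by (induction n) (simp_all add: mult.assoc)

datatype ptree = Lf nat | Nd nat ptree ptree

primrec root :: "ptree \<Rightarrow> nat" where
  "root (Lf h) = h"
| "root (Nd h l r) = h"

primrec leaves :: "ptree \<Rightarrow> nat" where
  "leaves (Lf h) = 1"
| "leaves (Nd h l r) = leaves l + leaves r"

primrec labels :: "ptree \<Rightarrow> nat set" where
  "labels (Lf h) = {h}"
| "labels (Nd h l r) = insert h (labels l \<union> labels r)"

text \<open>
  A node is recorded as its label, its number of leaves, and the number of leaves of its left
  subtree (\<open>0\<close> at a leaf). Since a tree with \<open>i\<close> leaves has \<open>2 * i - 1\<close> nodes, the right child of a node
  with \<open>j\<close> leaves on the left is \<open>2 * j\<close> positions further on. Hence being a preorder listing is a
  condition on pairs of positions.
\<close>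

primrec preorder :: "ptree \<Rightarrow> (nat \<times> nat \<times> nat) list" where
  "preorder (Lf h) = [(h, 1, 0)]"
| "preorder (Nd h l r) = (h, leaves l + leaves r, leaves l) # preorder l @ preorder r"

definition node_ok :: "nat \<times> nat \<times> nat \<Rightarrow> bool" where
  "node_ok = (\<lambda>(h, i, j). if j = 0 then i = 1 else j < i)"

lemma leaves_neq_0 [simp]: "leaves t \<noteq> 0"
  by (induction t) auto

lemma leaves_gr_0 [simp]: "leaves t > 0"
  by (simp add: zero_less_iff_neq_zero)

lemma length_preorder: "Suc (length (preorder t)) = 2 * leaves t"
  by (induction t) auto

lemma preorder_neq_Nil [simp]: "preorder t \<noteq> []"
  by (cases t) auto

lemma hd_preorder: "\<exists>j. preorder t ! 0 = (root t, leaves t, j)"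
  by (cases t) auto

lemma set_preorder: "set (preorder t) \<subseteq> labels t \<times> {..leaves t} \<times> {..leaves t}"
  by (induction t) fastforce+

lemma preorder_ok: "\<forall>x\<in>set (preorder t). node_ok x"
  by (induction t) (auto simp: node_ok_def)

text \<open>The first record fixes the number of leaves on the left, hence the place where the
  listing of the left subtree ends.\<close>

lemma preorder_inj: "preorder t = preorder t' \<Longrightarrow> t = t'"
proof (induction t arbitrary: t')
  case (Lf h)
  then show ?case by (cases t') auto
next
  case (Nd h l r)
  then obtain h' l' r' where t': "t' = Nd h' l' r'" by (cases t') auto
  have eq: "preorder l @ preorder r = preorder l' @ preorder r'" "h = h'" "leaves l = leaves l'"
    using Nd.prems t' by auto
  have "length (preorder l) = length (preorder l')"
    using length_preorder[of l] length_preorder[of l'] eq(3) by simp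
  then show ?case using eq Nd.IH t' by simp
qed

lemma labels_preorder: "labels t = fst ` set (preorder t)"
  by (induction t) (auto simp: image_Un)

definition trees :: "nat \<Rightarrow> nat \<Rightarrow> ptree set" where
  "trees H i = {t. leaves t = i \<and> labels t \<subseteq> {..<H}}"

lemma finite_trees [simp]: "finite (trees H i)"
proof (rule finite_imageD)
  have "preorder ` trees H i \<subseteq> {xs. set xs \<subseteq> {..<H} \<times> {..i} \<times> {..i} \<and> length xs = 2 * i - 1}"
  proof safe
    fix t h i' j
    assume t: "t \<in> trees H i" and x: "(h, i', j) \<in> set (preorder t)"
    show "h < H" "i' \<le> i" "j \<le> i"
      using set_preorder[of t] t x by (auto simp: trees_def)
  next
    fix t assume "t \<in> trees H i"
    then show "length (preorder t) = 2 * i - 1"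
      using length_preorder[of t] by (simp add: trees_def)
  qed
  then show "finite (preorder ` trees H i)"
    by (rule finite_subset) (intro finite_lists_length_eq finite_cartesian_product; simp)
qed (meson inj_onI preorder_inj)

lemma trees_1: "trees H 1 = Lf ` {..<H}"
proof -
  have "leaves t = 1 \<Longrightarrow> \<exists>h. t = Lf h" for t
    by (cases t) (auto simp: add_is_1)
  then show ?thesis by (force simp: trees_def)
qed

lemma root_trees: "t \<in> trees H i \<Longrightarrow> root t < H"
  by (cases t) (auto simp: trees_def)

section \<open>Weights of preorder listings\<close>

locale grammar =
  fixes H :: nat and \<alpha> \<beta> :: "nat \<Rightarrow> nat \<Rightarrow> 'a::comm_semiring_1"
begin

text \<open>A child of the wrong size gives 0, so a nonzero weight enforces the shape of the tree,
  while the other values multiply to its weight. The two distances never coincide, since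
  \<open>2 * j > 1\<close> at an inner node.\<close>

definition link :: "nat \<Rightarrow> nat \<times> nat \<times> nat \<Rightarrow> nat \<times> nat \<times> nat \<Rightarrow> 'a" where
  "link d = (\<lambda>(h, i, j) (h', i', j').
     if j = 0 then 1
     else if d = 1 then (if i' = j then \<alpha> h h' else 0)
     else if d = 2 * j then (if i' = i - j then \<beta> h h' else 0)
     else 1)"

fun weight :: "(nat \<times> nat \<times> nat) list \<Rightarrow> 'a" where
  "weight [] = 1"
| "weight (x # xs) = (\<Prod>b<length xs. link (Suc b) x (xs ! b)) * weight xs"

primrec tree_weight :: "ptree \<Rightarrow> 'a" where
  "tree_weight (Lf h) = 1"
| "tree_weight (Nd h l r) = \<alpha> h (root l) * \<beta> h (root r) * (tree_weight l * tree_weight r)"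

lemma weight_nth:
  "weight xs = (\<Prod>a<length xs. \<Prod>b<length xs. if a < b then link (b - a) (xs ! a) (xs ! b) else 1)"
proof (induction xs)
  case (Cons x xs)
  show ?case
    by (simp add: prod.lessThan_Suc_shift Cons del: prod.lessThan_Suc cong: if_cong)
qed simp

lemma weight_append:
  "weight (xs @ ys) = weight xs * weight ys *
    (\<Prod>a<length xs. \<Prod>b<length ys. link (length xs - a + b) (xs ! a) (ys ! b))"
proof (induction xs)
  case (Cons x xs)
  have "(\<Prod>b<length xs + length ys. link (Suc b) x ((xs @ ys) ! b)) =
      (\<Prod>b<length xs. link (Suc b) x (xs ! b)) * (\<Prod>b<length ys. link (Suc (length xs + b)) x (ys ! b))"
    by (simp add: prod_lessThan_add nth_append)
  then show ?case
    by (simp add: Cons prod.lessThan_Suc_shift ac_simps del: prod.lessThan_Suc)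
qed simp

text \<open>The farthest record that a node refers to is its right child, which belongs to the same
  tree. So no link leaves the listing of a tree, and weights multiply when something is appended to
  it.\<close>

lemma preorder_links_inside:
  "a < length (preorder t) \<Longrightarrow> preorder t ! a = (h, i, j) \<Longrightarrow> a + 2 * j < length (preorder t)"
proof (induction t arbitrary: a)
  case (Nd g l r)
  show ?case
  proof (cases a)
    case 0
    have "2 * leaves l < Suc (length (preorder l) + length (preorder r))"
      using length_preorder[of l] length_preorder[of r] leaves_gr_0[of r] by linarith
    then show ?thesis using Nd.prems 0 by simp
  next
    case (Suc b)
    show ?thesis
    proof (cases "b < length (preorder l)")
      case True
      then show ?thesis using Nd.prems Nd.IH(1)[of b] Suc by (simp add: nth_append)
    next
      case False
      then have "b - length (preorder l) + 2 * j < length (preorder r)"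
        using Nd.prems Suc by (intro Nd.IH(2)) (auto simp: nth_append)
      then show ?thesis using False Suc by simp
    qed
  qed
qed simp

lemma weight_append_preorder: "weight (preorder t @ ys) = weight (preorder t) * weight ys"
proof -
  have "link (length (preorder t) - a + b) (preorder t ! a) y = 1" if "a < length (preorder t)" for a b y
  proof -
    obtain h i j where x: "preorder t ! a = (h, i, j)" by (metis prod_cases3)
    then show ?thesis
      using preorder_links_inside[OF that x] by (cases y) (auto simp: link_def)
  qed
  then show ?thesis by (simp add: weight_append)
qed

lemma weight_preorder: "weight (preorder t) = tree_weight t"
proof (induction t)
  case (Nd h l r)
  \<comment> \<open>In each subtree only the first record is linked to the new root: distance 1
    occurs at the start of the left listing, and distance \<open>2 * leaves l = Suc ?n\<close> at
    the start of the right one.\<close>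
  have first: "(\<Prod>b<n. f b) = f 0" if "n > 0" "\<And>b. 0 < b \<Longrightarrow> b < n \<Longrightarrow> f b = 1" for n and f :: "nat \<Rightarrow> 'a"
    using that by (cases n) (auto simp: prod.lessThan_Suc_shift simp del: prod.lessThan_Suc intro: prod.neutral)
  let ?x = "(h, leaves l + leaves r, leaves l)"
  let ?n = "length (preorder l)" and ?m = "length (preorder r)"
  have n: "Suc ?n = 2 * leaves l" by (rule length_preorder)
  have l: "(\<Prod>b<?n. link (Suc b) ?x (preorder l ! b)) = \<alpha> h (root l)"
  proof (subst first)
    show "link (Suc 0) ?x (preorder l ! 0) = \<alpha> h (root l)"
      using hd_preorder[of l] by (auto simp: link_def)
    show "link (Suc b) ?x (preorder l ! b) = 1" if "0 < b" "b < ?n" for b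
      using that n by (cases "preorder l ! b") (auto simp: link_def)
  qed auto
  have r: "(\<Prod>b<?m. link (Suc (?n + b)) ?x (preorder r ! b)) = \<beta> h (root r)"
  proof (subst first)
    show "link (Suc (?n + 0)) ?x (preorder r ! 0) = \<beta> h (root r)"
      using hd_preorder[of r] n leaves_neq_0[of l] by (auto simp: link_def)
    show "link (Suc (?n + b)) ?x (preorder r ! b) = 1" if "0 < b" "b < ?m" for b
      using that n leaves_neq_0[of l] by (cases "preorder r ! b") (auto simp: link_def)
  qed auto
  have "(\<Prod>b<?n + ?m. link (Suc b) ?x ((preorder l @ preorder r) ! b)) = \<alpha> h (root l) * \<beta> h (root r)"
    using l r by (simp add: prod_lessThan_add nth_append)
  then show ?case by (simp add: weight_append_preorder Nd)
qed simp

text \<open>The first record says where to cut the rest. Its two links force the sizes stated at the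
  heads of both parts, whose weights are factors of the whole weight, so induction on the number of
  leaves applies.\<close>

lemma weight_nonzero_preorder:
  assumes "length xs = 2 * i - 1" "xs ! 0 = (h, i, j)" "\<forall>x\<in>set xs. node_ok x" "weight xs \<noteq> 0" "i > 0"
  shows "\<exists>t. xs = preorder t"
  using assms
proof (induction i arbitrary: xs h j rule: less_induct)
  case (less i)
  then obtain rest where xs: "xs = (h, i, j) # rest"
    by (cases xs) auto
  have ok: "node_ok (h, i, j)" using less.prems(3) xs by simp
  show ?case
  proof (cases "j = 0")
    case True
    then have "xs = preorder (Lf h)" using ok less.prems(1) xs by (simp add: node_ok_def)
    then show ?thesis ..
  next
    case False
    then have j: "0 < j" "j < i" using ok by (auto simp: node_ok_def)
    define ys zs where "ys = take (2 * j - 1) rest" and "zs = drop (2 * j - 1) rest"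
    have rest: "rest = ys @ zs" by (simp add: ys_def zs_def)
    have len: "length ys = 2 * j - 1" "length zs = 2 * (i - j) - 1"
      using less.prems(1) j by (auto simp: ys_def zs_def xs)
    have nz: "(\<Prod>b<length rest. link (Suc b) (h, i, j) (rest ! b)) \<noteq> 0" "weight rest \<noteq> 0"
      using less.prems(4) unfolding xs by auto
    have W: "weight ys \<noteq> 0" "weight zs \<noteq> 0"
      using nz(2) by (auto simp: rest weight_append)
    have link: "link (Suc b) (h, i, j) (rest ! b) \<noteq> 0" if "b < length rest" for b
      using nz(1) that by (metis finite_lessThan lessThan_iff prod_zero)
    obtain h1 i1 j1 where 1: "ys ! 0 = (h1, i1, j1)" by (metis prod_cases3)
    obtain h2 i2 j2 where 2: "zs ! 0 = (h2, i2, j2)" by (metis prod_cases3)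
    have r0: "rest ! 0 = ys ! 0" "rest ! (2 * j - 1) = zs ! 0" "2 * j - 1 < length rest" "rest \<noteq> []"
      using len j by (auto simp: rest nth_append)
    have "i1 = j" "i2 = i - j"
      using link[of 0] link[of "2 * j - 1"] r0 j 1 2 by (auto simp: link_def split: if_splits)
    moreover have "\<forall>x\<in>set ys. node_ok x" "\<forall>x\<in>set zs. node_ok x"
      using less.prems(3) by (auto simp: xs rest)
    ultimately obtain l r where lr: "ys = preorder l" "zs = preorder r"
      using less.IH[of j ys h1 j1] less.IH[of "i - j" zs h2 j2] len j W 1 2 by auto
    have "leaves l = j" "leaves r = i - j"
      using len lr j length_preorder[of l] length_preorder[of r] by auto
    then have "xs = preorder (Nd h l r)"
      using lr j by (simp add: xs rest)
    then show ?thesis ..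
  qed
qed

end

section \<open>Sums over parse trees as sums over assignments\<close>

lemma sum_lists_append:
  "(\<Sum>xs | set xs \<subseteq> A \<and> length xs = m + n. F xs) =
   (\<Sum>xs | set xs \<subseteq> A \<and> length xs = m. \<Sum>ys | set ys \<subseteq> A \<and> length ys = n. F (xs @ ys))"
proof -
  have "(\<Sum>xs | set xs \<subseteq> A \<and> length xs = m. \<Sum>ys | set ys \<subseteq> A \<and> length ys = n. F (xs @ ys)) =
    (\<Sum>(xs, ys)\<in>{xs. set xs \<subseteq> A \<and> length xs = m} \<times> {ys. set ys \<subseteq> A \<and> length ys = n}. F (xs @ ys))"
    by (rule sum.cartesian_product)
  also have "\<dots> = (\<Sum>xs | set xs \<subseteq> A \<and> length xs = m + n. F xs)"
    by (rule sum.reindex_bij_witness[of _ "\<lambda>xs. (take m xs, drop m xs)" "\<lambda>(xs, ys). xs @ ys"])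
      (auto dest: in_set_takeD in_set_dropD)
  finally show ?thesis ..
qed

lemma sum_PiE_lists:
  assumes "inj_on c B" "finite B"
  shows "(\<Sum>e\<in>{..<m} \<rightarrow>\<^sub>E B. F (map (\<lambda>a. c (e a)) [0..<m])) = (\<Sum>xs | set xs \<subseteq> c ` B \<and> length xs = m. F xs)"
proof (rule sum.reindex_bij_witness[of _ "\<lambda>xs. \<lambda>a\<in>{..<m}. inv_into B c (xs ! a)" "\<lambda>e. map (\<lambda>a. c (e a)) [0..<m]"])
  fix e assume e: "e \<in> {..<m} \<rightarrow>\<^sub>E B"
  show "(\<lambda>a\<in>{..<m}. inv_into B c (map (\<lambda>a. c (e a)) [0..<m] ! a)) = e"
  proof
    fix a show "(\<lambda>a\<in>{..<m}. inv_into B c (map (\<lambda>a. c (e a)) [0..<m] ! a)) a = e a"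
      using PiE_mem[OF e, of a] PiE_arb[OF e, of a] assms(1) by (cases "a < m") auto
  qed
next
  fix xs assume xs: "xs \<in> {xs. set xs \<subseteq> c ` B \<and> length xs = m}"
  then have "xs ! a \<in> c ` B" if "a < m" for a using that by auto
  then show "map (\<lambda>a. c ((\<lambda>a\<in>{..<m}. inv_into B c (xs ! a)) a)) [0..<m] = xs"
    "(\<lambda>a\<in>{..<m}. inv_into B c (xs ! a)) \<in> {..<m} \<rightarrow>\<^sub>E B"
    using xs by (auto intro!: nth_equalityI simp: f_inv_into_f inv_into_into)
qed (auto simp: PiE_def Pi_def)

primrec tree_word :: "(nat \<Rightarrow> 'b::monoid_mult) \<Rightarrow> ptree \<Rightarrow> 'b" where
  "tree_word lb (Lf h) = lb h"
| "tree_word lb (Nd h l r) = tree_word lb l * tree_word lb r"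

lemma tree_word_preorder:
  "tree_word lb t = prod_list (map (\<lambda>x. if snd (snd x) = 0 then lb (fst x) else 1) (preorder t))"
  by (induction t) auto

lemma nc_const_mult_swap: "nc_const a * f * (nc_const b * g) = nc_const (a * b) * (f * g)"
  for a b :: "'a::comm_semiring_1"
proof -
  have "nc_const a * f * (nc_const b * g) = nc_const a * (f * nc_const b) * g"
    by (simp only: mult.assoc)
  also have "\<dots> = nc_const (a * b) * (f * g)"
    by (simp only: nc_const_commute[of f] nc_const_mult mult.assoc)
  finally show ?thesis .
qed

lemma tree_word_nc_const:
  "tree_word (\<lambda>h. nc_const (c h) * lb h) t = nc_const (tree_word c t) * tree_word lb t"
  for c :: "nat \<Rightarrow> 'a::comm_semiring_1"
  by (induction t) (simp_all add: nc_const_mult_swap)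

context grammar
begin

definition tree_sum :: "(nat \<Rightarrow> ('x, 'a) ncpoly) \<Rightarrow> nat \<Rightarrow> nat \<Rightarrow> ('x, 'a) ncpoly" where
  "tree_sum lb i h = (\<Sum>t | t \<in> trees H i \<and> root t = h. nc_const (tree_weight t) * tree_word lb t)"

lemma tree_sum_1:
  assumes "h < H"
  shows "tree_sum lb 1 h = lb h"
proof -
  have "{t. t \<in> trees H 1 \<and> root t = h} = {Lf h}"
    using assms unfolding trees_1 by auto
  then show ?thesis by (simp add: tree_sum_def)
qed

lemma tree_sum_root:
  "(\<Sum>h'<H. nc_const (c h') * tree_sum lb i h') =
   (\<Sum>t\<in>trees H i. nc_const (c (root t) * tree_weight t) * tree_word lb t)"
proof -
  have "(\<Sum>t\<in>trees H i. nc_const (c (root t) * tree_weight t) * tree_word lb t) =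
      (\<Sum>h'<H. \<Sum>t | t \<in> trees H i \<and> root t = h'. nc_const (c (root t) * tree_weight t) * tree_word lb t)"
    by (rule sum.group[symmetric]) (auto simp: root_trees)
  also have "\<dots> = (\<Sum>h'<H. nc_const (c h') * tree_sum lb i h')"
    unfolding tree_sum_def sum_distrib_left
    by (intro sum.cong) (auto simp: nc_const_mult mult.assoc)
  finally show ?thesis ..
qed

text \<open>The tree is cut at its root. An edge weight depends only on the labels of its ends, so
  it moves into the sum over the label of the child; this is the recursion of a grammar in Chomsky
  normal form.\<close>

lemma tree_sum_rec:
  assumes "i \<ge> 2" "h < H"
  shows "tree_sum lb i h = (\<Sum>j=1..<i.
    (\<Sum>h'<H. nc_const (\<alpha> h h') * tree_sum lb j h') * (\<Sum>h'<H. nc_const (\<beta> h h') * tree_sum lb (i - j) h'))"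
proof -
  let ?D = "Sigma {1..<i} (\<lambda>j. trees H j \<times> trees H (i - j))"
  let ?f = "\<lambda>(j :: nat, l, r). Nd h l r"
  let ?F = "\<lambda>t. nc_const (tree_weight t) * tree_word lb t"
  have "{t. t \<in> trees H i \<and> root t = h} = ?f ` ?D"
  proof (intro equalityI subsetI)
    fix t assume "t \<in> {t. t \<in> trees H i \<and> root t = h}"
    then have t: "t \<in> trees H i" "root t = h" by auto
    then obtain g l r where "t = Nd g l r"
      using assms(1) by (cases t) (auto simp: trees_def)
    moreover have "leaves l \<ge> 1" "leaves r \<ge> 1" by (simp_all add: Suc_le_eq)
    ultimately show "t \<in> ?f ` ?D"
      using t by (intro image_eqI[of _ _ "(leaves l, l, r)"]) (auto simp: trees_def)
  qed (use assms(2) in \<open>auto simp: trees_def\<close>)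
  moreover have "inj_on ?f ?D" by (auto simp: inj_on_def trees_def)
  ultimately have "tree_sum lb i h = (\<Sum>x\<in>?D. ?F (?f x))"
    unfolding tree_sum_def by (simp add: sum.reindex o_def)
  also have "\<dots> = (\<Sum>j=1..<i. \<Sum>(l, r)\<in>trees H j \<times> trees H (i - j). ?F (Nd h l r))"
    by (subst sum.Sigma) (auto intro!: sum.cong)
  also have "\<dots> = (\<Sum>j=1..<i. (\<Sum>l\<in>trees H j. nc_const (\<alpha> h (root l) * tree_weight l) * tree_word lb l) *
      (\<Sum>r\<in>trees H (i - j). nc_const (\<beta> h (root r) * tree_weight r) * tree_word lb r))"
  proof (rule sum.cong)
    fix j
    have eq: "?F (Nd h l r) = (nc_const (\<alpha> h (root l) * tree_weight l) * tree_word lb l) *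
        (nc_const (\<beta> h (root r) * tree_weight r) * tree_word lb r)" for l r
      by (simp only: nc_const_mult_swap tree_weight.simps tree_word.simps) (simp only: ac_simps)
    show "(\<Sum>(l, r)\<in>trees H j \<times> trees H (i - j). ?F (Nd h l r)) =
      (\<Sum>l\<in>trees H j. nc_const (\<alpha> h (root l) * tree_weight l) * tree_word lb l) *
      (\<Sum>r\<in>trees H (i - j). nc_const (\<beta> h (root r) * tree_weight r) * tree_word lb r)"
      by (simp only: eq sum_product sum.cartesian_product)
  qed simp
  finally show ?thesis by (simp only: tree_sum_root)
qed

lemma sum_preorder:
  assumes "h0 < H" "D > 0"
    and zero: "\<And>ns. length ns = 2 * D - 1 \<Longrightarrow> \<not> (\<forall>x\<in>set ns. node_ok x) \<or> fst (ns ! 0) \<noteq> h0 \<or> fst (snd (ns ! 0)) \<noteq> D \<or> weight ns = 0 \<Longrightarrow> F ns = 0"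
  shows "(\<Sum>ns | set ns \<subseteq> {..<H} \<times> {..D} \<times> {..D} \<and> length ns = 2 * D - 1. F ns) =
    (\<Sum>t | t \<in> trees H D \<and> root t = h0. F (preorder t))"
proof -
  let ?N = "{ns. set ns \<subseteq> {..<H} \<times> {..D} \<times> {..D} \<and> length ns = 2 * D - 1}"
  let ?T = "{t. t \<in> trees H D \<and> root t = h0}"
  have "(\<Sum>ns\<in>?N. F ns) = (\<Sum>ns\<in>preorder ` ?T. F ns)"
  proof (rule sum.mono_neutral_right)
    show "finite ?N" by (intro finite_lists_length_eq finite_cartesian_product; simp)
    show "preorder ` ?T \<subseteq> ?N"
    proof safe
      fix t h i j
      assume t: "t \<in> trees H D" and x: "(h, i, j) \<in> set (preorder t)"
      show "h < H" "i \<le> D" "j \<le> D"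
        using set_preorder[of t] t x by (auto simp: trees_def)
    next
      fix t assume "t \<in> trees H D"
      then show "length (preorder t) = 2 * D - 1"
        using length_preorder[of t] by (simp add: trees_def)
    qed
    show "\<forall>ns\<in>?N - preorder ` ?T. F ns = 0"
    proof
      fix ns assume ns: "ns \<in> ?N - preorder ` ?T"
      show "F ns = 0"
      proof (rule ccontr)
        assume "F ns \<noteq> 0"
        then have ok: "\<forall>x\<in>set ns. node_ok x" "fst (ns ! 0) = h0" "fst (snd (ns ! 0)) = D" "weight ns \<noteq> 0"
          using zero[of ns] ns by auto
        then obtain j where "ns ! 0 = (h0, D, j)" by (metis prod.collapse)
        with weight_nonzero_preorder[of ns D h0 j] ns ok assms(2) obtain t where t: "ns = preorder t" by auto
        then have "leaves t = D" "root t = h0"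
          using hd_preorder[of t] ok by auto
        moreover have "labels t \<subseteq> {..<H}" using ns t unfolding labels_preorder by auto
        ultimately show False using ns t by (auto simp: trees_def)
      qed
    qed
  qed
  also have "\<dots> = (\<Sum>t\<in>?T. F (preorder t))"
    by (subst sum.reindex) (auto intro: inj_onI preorder_inj)
  finally show ?thesis .
qed

text \<open>The label read at a position may depend only on the value there, but a summed variable
  gets its value at another position. It therefore enters as a scalar, the weight of a pair of
  positions.\<close>

definition bit_weight :: "(nat \<Rightarrow> nat option) \<Rightarrow> (nat \<Rightarrow> 'a) \<Rightarrow> nat \<Rightarrow> 'a" where
  "bit_weight bvar e h = (case bvar h of None \<Rightarrow> 1 | Some q \<Rightarrow> e q)"

lemma tree_sum_projection:
  assumes h0: "h0 < H" and H: "H \<ge> 2" and D: "D > 0"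
    and base: "\<And>h. base h \<in> range nc_var \<union> range nc_const"
    and bvar: "\<And>h q. bvar h = Some q \<Longrightarrow> q < m"
    and K_def: "K = m + (2 * D - 1)" and N_def: "N = H * (Suc D * Suc D)"
  shows "\<exists>n\<ge>1. n \<le> Suc (K * N) + 3 * (2 * (K * K) * (K * N)) \<and>
    projection
      (\<Sum>e\<in>{..<m} \<rightarrow>\<^sub>E {0, 1}. tree_sum (\<lambda>h. nc_const (bit_weight bvar e h) * base h) D h0) (HC n)"
proof -
  let ?n = "2 * D - 1"
  let ?Dom = "{..<H} \<times> {..D} \<times> {..D}"
  \<comment> \<open>All columns share one domain, so bits are stored as records with label 0 or 1,
    which fit because \<open>H \<ge> 2\<close>.\<close>
  define c :: "'a \<Rightarrow> nat \<times> nat \<times> nat" where "c b = (if b = 1 then (1, 0, 0) else (0, 0, 0))" for b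
  define dec :: "nat \<times> nat \<times> nat \<Rightarrow> 'a" where "dec x = (if x = (1, 0, 0) then 1 else 0)" for x
  have dec_c: "dec (c b) = b" if "b \<in> {0, 1}" for b
    using that by (auto simp: dec_def c_def)
  \<comment> \<open>Unary conditions for the diagonal of \<open>W\<close>: the first
    \<open>m\<close> columns hold bits, the others admissible records, starting with the prescribed
    root.\<close>
  define U1 :: "nat \<times> nat \<times> nat \<Rightarrow> 'a" where "U1 x = (if x \<in> c ` {0, 1} then 1 else 0)" for x
  define U2 :: "nat \<Rightarrow> nat \<times> nat \<times> nat \<Rightarrow> 'a" where
    "U2 b x = (if node_ok x \<and> (b = 0 \<longrightarrow> fst x = h0 \<and> fst (snd x) = D) then 1 else 0)" for b x
  define Bt where "Bt a x y = (if snd (snd y) = 0 \<and> bvar (fst y) = Some a then dec x else 1)"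
    for a :: nat and x y :: "nat \<times> nat \<times> nat"
  define W where "W a b x y =
    (if a < m then if b < m then if a = b then U1 x else 1 else Bt a x y
     else if b < m then 1 else if a = b then U2 (a - m) x else if a < b then link (b - a) x y else 1)"
    for a b :: nat and x y :: "nat \<times> nat \<times> nat"
  define L where "L k x = (if k < m then 1 else if snd (snd x) = 0 then base (fst x) else 1)"
    for k :: nat and x :: "nat \<times> nat \<times> nat"
  have W: "(\<Prod>a<m + ?n. \<Prod>b<m + ?n. W a b ((bs @ ns) ! a) ((bs @ ns) ! b)) =
      (\<Prod>a<m. U1 (bs ! a)) * ((\<Prod>a<m. \<Prod>b<?n. Bt a (bs ! a) (ns ! b)) * ((\<Prod>b<?n. U2 b (ns ! b)) * weight ns))"
    if bs: "length bs = m" and ns: "length ns = ?n" for bs ns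
  proof -
    have 1: "(\<Prod>b<m + ?n. W a b ((bs @ ns) ! a) ((bs @ ns) ! b)) = U1 (bs ! a) * (\<Prod>b<?n. Bt a (bs ! a) (ns ! b))"
      if a: "a < m" for a
    proof -
      have "(\<Prod>b<m. W a b ((bs @ ns) ! a) ((bs @ ns) ! b)) = (\<Prod>b<m. if b = a then U1 (bs ! a) else 1)"
        using a bs by (intro prod.cong) (auto simp: W_def nth_append)
      also have "\<dots> = U1 (bs ! a)" using a by simp
      finally show ?thesis
        using a bs by (simp add: prod_lessThan_add W_def nth_append)
    qed
    have 2: "(\<Prod>b<m + ?n. W (m + a) b ((bs @ ns) ! (m + a)) ((bs @ ns) ! b)) =
        U2 a (ns ! a) * (\<Prod>b<?n. if a < b then link (b - a) (ns ! a) (ns ! b) else 1)" if a: "a < ?n" for a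
    proof -
      have "(\<Prod>b<m + ?n. W (m + a) b ((bs @ ns) ! (m + a)) ((bs @ ns) ! b)) =
          (\<Prod>b<?n. W (m + a) (m + b) (ns ! a) (ns ! b))"
      proof -
        have "(bs @ ns) ! (m + b) = ns ! b" for b using bs by (simp add: nth_append)
        moreover have "(\<Prod>b<m. W (m + a) b x ((bs @ ns) ! b)) = 1" for x
          by (intro prod.neutral) (simp add: W_def)
        ultimately show ?thesis by (simp add: prod_lessThan_add)
      qed
      also have "\<dots> = (\<Prod>b<?n. (if b = a then U2 a (ns ! a) else 1) * (if a < b then link (b - a) (ns ! a) (ns ! b) else 1))"
        by (intro prod.cong) (auto simp: W_def)
      also have "\<dots> = U2 a (ns ! a) * (\<Prod>b<?n. if a < b then link (b - a) (ns ! a) (ns ! b) else 1)"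
        using a by (simp add: prod.distrib)
      finally show ?thesis .
    qed
    have "(\<Prod>a<m. \<Prod>b<m + ?n. W a b ((bs @ ns) ! a) ((bs @ ns) ! b)) =
        (\<Prod>a<m. U1 (bs ! a) * (\<Prod>b<?n. Bt a (bs ! a) (ns ! b)))"
      by (intro prod.cong refl 1) simp
    moreover have "(\<Prod>a<?n. \<Prod>b<m + ?n. W (m + a) b ((bs @ ns) ! (m + a)) ((bs @ ns) ! b)) =
        (\<Prod>a<?n. U2 a (ns ! a) * (\<Prod>b<?n. if a < b then link (b - a) (ns ! a) (ns ! b) else 1))"
      by (intro prod.cong refl 2) simp
    ultimately show ?thesis
      unfolding prod_lessThan_add[where m=m and n="?n" and f="\<lambda>a. \<Prod>b<m + ?n. W a b ((bs @ ns) ! a) ((bs @ ns) ! b)"]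
      by (simp only: prod.distrib weight_nth ns mult.assoc)
  qed
  have Lp: "prod_list (map (\<lambda>k. L k ((bs @ ns) ! k)) [0..<m + ?n]) =
      prod_list (map (\<lambda>x. if snd (snd x) = 0 then base (fst x) else 1) ns)"
    if bs: "length bs = m" and ns: "length ns = ?n" for bs ns
  proof -
    have "[0..<m + ?n] = [0..<m] @ map (\<lambda>i. i + m) [0..<?n]"
      unfolding map_add_upt by (metis add.commute le0 upt_add_eq_append)
    moreover have "prod_list (map (\<lambda>k. L k ((bs @ ns) ! k)) [0..<m]) = 1"
    proof -
      have "map (\<lambda>k. L k ((bs @ ns) ! k)) [0..<m] = map (\<lambda>_. 1) [0..<m]" by (simp add: L_def)
      then show ?thesis by (simp only: map_replicate_const) (simp add: prod_list_replicate)
    qed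
    moreover have "map ((\<lambda>k. L k ((bs @ ns) ! k)) \<circ> (\<lambda>i. i + m)) [0..<?n] =
        map (\<lambda>x. if snd (snd x) = 0 then base (fst x) else 1) ns"
      using bs ns by (intro nth_equalityI) (auto simp: L_def nth_append)
    ultimately show ?thesis
      by (simp only: map_append map_map prod_list.append mult_1_left)
  qed
  let ?G = "\<lambda>bs ns. nc_const ((\<Prod>a<m. U1 (bs ! a)) * ((\<Prod>a<m. \<Prod>b<?n. Bt a (bs ! a) (ns ! b)) *
      ((\<Prod>b<?n. U2 b (ns ! b)) * weight ns))) *
      prod_list (map (\<lambda>x. if snd (snd x) = 0 then base (fst x) else 1) ns)"
  let ?B = "{bs. set bs \<subseteq> c ` {0, 1} \<and> length bs = m}"
  let ?T = "{t. t \<in> trees H D \<and> root t = h0}"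
  have "(\<Sum>xs | set xs \<subseteq> ?Dom \<and> length xs = m + ?n.
      nc_const (\<Prod>a<m + ?n. \<Prod>b<m + ?n. W a b (xs ! a) (xs ! b)) * prod_list (map (\<lambda>k. L k (xs ! k)) [0..<m + ?n])) =
      (\<Sum>bs | set bs \<subseteq> ?Dom \<and> length bs = m. \<Sum>ns | set ns \<subseteq> ?Dom \<and> length ns = ?n. ?G bs ns)"
    unfolding sum_lists_append by (intro sum.cong refl) (simp only: W Lp mem_Collect_eq)
  also have "\<dots> = (\<Sum>bs\<in>?B. \<Sum>ns | set ns \<subseteq> ?Dom \<and> length ns = ?n. ?G bs ns)"
  proof (rule sum.mono_neutral_right)
    show "finite {bs. set bs \<subseteq> ?Dom \<and> length bs = m}"
      by (intro finite_lists_length_eq finite_cartesian_product; simp)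
    have "c ` {0, 1} \<subseteq> ?Dom" using H by (auto simp: c_def)
    then show "?B \<subseteq> {bs. set bs \<subseteq> ?Dom \<and> length bs = m}" by blast
    show "\<forall>bs\<in>{bs. set bs \<subseteq> ?Dom \<and> length bs = m} - ?B. (\<Sum>ns | set ns \<subseteq> ?Dom \<and> length ns = ?n. ?G bs ns) = 0"
    proof
      fix bs assume bs: "bs \<in> {bs. set bs \<subseteq> ?Dom \<and> length bs = m} - ?B"
      then obtain a where "a < m" "bs ! a \<notin> c ` {0, 1}"
        by (auto simp: subset_iff in_set_conv_nth simp del: image_insert image_empty)
      then have "(\<Prod>a<m. U1 (bs ! a)) = 0"
        by (intro prod_zero) (auto simp: U1_def simp del: image_insert image_empty)
      then show "(\<Sum>ns | set ns \<subseteq> ?Dom \<and> length ns = ?n. ?G bs ns) = 0" by simp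
    qed
  qed
  also have "\<dots> = (\<Sum>bs\<in>?B. \<Sum>t\<in>?T. ?G bs (preorder t))"
  proof (rule sum.cong[OF refl], rule sum_preorder[OF h0 D])
    fix bs ns
    assume len: "length ns = ?n"
      and *: "\<not> (\<forall>x\<in>set ns. node_ok x) \<or> fst (ns ! 0) \<noteq> h0 \<or> fst (snd (ns ! 0)) \<noteq> D \<or> weight ns = 0"
    have "(\<Prod>b<?n. U2 b (ns ! b)) * weight ns = 0"
    proof (cases "weight ns = 0")
      case False
      have "\<exists>b<?n. U2 b (ns ! b) = 0"
      proof (cases "\<forall>x\<in>set ns. node_ok x")
        case True
        then have "U2 0 (ns ! 0) = 0" using * False by (auto simp: U2_def)
        then show ?thesis using D by (intro exI[of _ 0]) simp
      next
        case False
        then obtain b where "b < ?n" "\<not> node_ok (ns ! b)" using len by (metis in_set_conv_nth)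
        then show ?thesis by (intro exI[of _ b]) (simp add: U2_def)
      qed
      then obtain b where "b < ?n" "U2 b (ns ! b) = 0" by auto
      then have "(\<Prod>b<?n. U2 b (ns ! b)) = 0" by (intro prod_zero) auto
      then show ?thesis by simp
    qed simp
    then show "?G bs ns = 0" by simp
  qed
  also have "\<dots> = (\<Sum>e\<in>{..<m} \<rightarrow>\<^sub>E {0, 1}. \<Sum>t\<in>?T. ?G (map (\<lambda>a. c (e a)) [0..<m]) (preorder t))"
    by (rule sum_PiE_lists[symmetric]) (auto simp: inj_on_def c_def)
  also have "\<dots> = (\<Sum>e\<in>{..<m} \<rightarrow>\<^sub>E {0, 1}. tree_sum (\<lambda>h. nc_const (bit_weight bvar e h) * base h) D h0)"
    unfolding tree_sum_def
  proof (intro sum.cong refl)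
    fix e t assume e: "e \<in> {..<m} \<rightarrow>\<^sub>E {0, 1::'a}" and t: "t \<in> ?T"
    let ?bs = "map (\<lambda>a. c (e a)) [0..<m]" and ?ns = "preorder t"
    have len: "length ?ns = ?n" using t length_preorder[of t] by (auto simp: trees_def)
    have U1: "(\<Prod>a<m. U1 (?bs ! a)) = 1"
      using e by (intro prod.neutral) (auto simp: U1_def simp del: image_insert image_empty)
    have U2: "(\<Prod>b<?n. U2 b (?ns ! b)) = 1"
    proof (intro prod.neutral ballI)
      fix b assume "b \<in> {..<?n}"
      then have "node_ok (?ns ! b)" using preorder_ok[of t] len by auto
      moreover have "fst (?ns ! 0) = h0 \<and> fst (snd (?ns ! 0)) = D"
        using hd_preorder[of t] t by (auto simp: trees_def)
      ultimately show "U2 b (?ns ! b) = 1" by (auto simp: U2_def)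
    qed
    let ?bw = "\<lambda>x. if snd (snd x) = 0 then bit_weight bvar e (fst x) else 1"
    have "(\<Prod>a<m. Bt a (?bs ! a) y) = ?bw y" for y
    proof (cases "snd (snd y) = 0")
      case True
      show ?thesis
      proof (cases "bvar (fst y)")
        case None
        then show ?thesis by (simp add: Bt_def bit_weight_def)
      next
        case (Some q)
        have "(\<Prod>a<m. Bt a (?bs ! a) y) = (\<Prod>a<m. if a = q then e q else 1)"
          using True Some e by (intro prod.cong) (auto simp: Bt_def dec_c[OF PiE_mem[OF e]])
        then show ?thesis using bvar[OF Some] Some True by (simp add: bit_weight_def)
      qed
    qed (simp add: Bt_def)
    then have "(\<Prod>a<m. \<Prod>b<?n. Bt a (?bs ! a) (?ns ! b)) = (\<Prod>b<?n. ?bw (?ns ! b))"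
      by (subst prod.swap) simp
    also have "\<dots> = prod_list (map ?bw ?ns)"
      unfolding prod.list_conv_set_nth using len by (simp add: lessThan_atLeast0)
    also have "\<dots> = tree_word (bit_weight bvar e) t" by (simp only: tree_word_preorder)
    finally show "?G ?bs ?ns = nc_const (tree_weight t) * tree_word (\<lambda>h. nc_const (bit_weight bvar e h) * base h) t"
      by (simp only: U1 U2 mult_1_left weight_preorder tree_word_nc_const nc_const_mult
          tree_word_preorder[of base, symmetric])
        (simp only: nc_const_mult[symmetric] mult.assoc[symmetric] mult.commute)
  qed
  finally have eq: "(\<Sum>xs | set xs \<subseteq> ?Dom \<and> length xs = K.
      nc_const (\<Prod>a<K. \<Prod>b<K. W a b (xs ! a) (xs ! b)) * prod_list (map (\<lambda>k. L k (xs ! k)) [0..<K])) =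
      (\<Sum>e\<in>{..<m} \<rightarrow>\<^sub>E {0, 1}. tree_sum (\<lambda>h. nc_const (bit_weight bvar e h) * base h) D h0)"
    unfolding K_def .
  have "finite ?Dom" "card ?Dom = N" by (simp_all add: N_def)
  moreover have "L k v \<in> range nc_var \<union> range nc_const" for k v
    using base by (auto simp: L_def intro!: range_eqI[of _ _ 1] simp flip: nc_const_1)
  moreover have "K > 0" using D by (simp add: K_def)
  ultimately show ?thesis
    using csp_projection[of ?Dom K L W] unfolding eq by simp
qed

end

section \<open>From circuits to grammars\<close>

definition hcomp :: "nat \<Rightarrow> ('x, 'a::comm_monoid_add) ncpoly \<Rightarrow> ('x, 'a) ncpoly" where
  "hcomp j f = (\<Sum>w\<in>Poly_Mapping.keys f.
     Poly_Mapping.single w (if length (letters w) = j then Poly_Mapping.lookup f w else 0))"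

lemma lookup_hcomp:
  "Poly_Mapping.lookup (hcomp j f) w = (if length (letters w) = j then Poly_Mapping.lookup f w else 0)"
  by (auto simp: hcomp_def lookup_sum lookup_single when_def in_keys_iff)

lemma hcomp_0 [simp]: "hcomp j 0 = 0"
  by (rule poly_mapping_eqI) (simp add: lookup_hcomp)

lemma hcomp_add: "hcomp j (f + g) = hcomp j f + hcomp j g"
  by (rule poly_mapping_eqI) (simp add: lookup_hcomp lookup_add)

lemma hcomp_single:
  "hcomp j (Poly_Mapping.single w c) = (if length (letters w) = j then Poly_Mapping.single w c else 0)"
  by (rule poly_mapping_eqI) (auto simp: lookup_hcomp lookup_single when_def)

lemma hcomp_const: "j > 0 \<Longrightarrow> hcomp j (nc_const c) = 0"
  by (simp add: nc_const_def hcomp_single zero_nc_word_def)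

lemma hcomp_var: "hcomp j (nc_var x) = (if j = 1 then nc_var x else 0)"
  by (simp add: nc_var_def hcomp_single)

lemma hcomp_0_index: "hcomp 0 f = nc_const (Poly_Mapping.lookup f 0)"
proof (rule poly_mapping_eqI)
  fix w :: "'a nc_word"
  show "Poly_Mapping.lookup (hcomp 0 f) w = Poly_Mapping.lookup (nc_const (Poly_Mapping.lookup f 0)) w"
    by (cases w) (auto simp: lookup_hcomp nc_const_def lookup_single when_def zero_nc_word_def)
qed

lemma hcomp_mult: "hcomp j (f * g) = (\<Sum>i\<le>j. hcomp i f * hcomp (j - i) g)"
  for f :: "('x, 'a::semiring_0) ncpoly"
proof (induction f arbitrary: g rule: ncpoly_induct)
  case (single u a)
  show ?case
  proof (induction g rule: ncpoly_induct)
    case (single v b)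
    let ?m = "length (letters u)" and ?n = "length (letters v)"
    have "(\<Sum>i\<le>j. hcomp i (Poly_Mapping.single u a) * hcomp (j - i) (Poly_Mapping.single v b)) =
        (\<Sum>i\<le>j. if i = ?m then (if ?m + ?n = j then Poly_Mapping.single (u + v) (a * b) else 0) else 0)"
      by (intro sum.cong) (auto simp: hcomp_single mult_single)
    then show ?case
      by (auto simp: mult_single hcomp_single plus_nc_word_def)
  qed (simp add: distrib_left hcomp_add sum.distrib)
qed (simp add: distrib_right hcomp_add sum.distrib)

lemma sum_hcomp:
  assumes "nc_degree f \<le> D"
  shows "(\<Sum>j\<le>D. hcomp j f) = f"
proof (rule poly_mapping_eqI)
  fix w
  have "length (letters w) \<le> D" if "Poly_Mapping.lookup f w \<noteq> 0"
  proof -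
    have "length (letters w) \<le> nc_degree f"
      unfolding nc_degree_def using that by (intro Max_ge) (auto simp: in_keys_iff)
    then show ?thesis using assms by simp
  qed
  then show "Poly_Mapping.lookup (\<Sum>j\<le>D. hcomp j f) w = Poly_Mapping.lookup f w"
    by (auto simp: lookup_sum lookup_hcomp)
qed

lemma circuit_values_snoc:
  "circuit_values (C @ [g]) = circuit_values C @ [gate_value (circuit_values C) g]"
  by (simp add: circuit_values_def)

lemma length_circuit_values [simp]: "length (circuit_values C) = length C"
  by (induction C rule: rev_induct) (simp_all add: circuit_values_snoc, simp add: circuit_values_def)

lemma circuit_values_nth:
  assumes "\<forall>k<length C. gate_inputs (C ! k) \<subseteq> {..<k}" "k < length C"
  shows "circuit_values C ! k = gate_value (circuit_values C) (C ! k)"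
  using assms
proof (induction C arbitrary: k rule: rev_induct)
  case (snoc g C)
  have val: "gate_value (vs @ ws) h = gate_value vs h" if "gate_inputs h \<subseteq> {..<length vs}" for vs ws :: "('a, 'b) ncpoly list" and h
    using that by (cases h) (auto simp: nth_append)
  have g: "gate_inputs g \<subseteq> {..<length C}"
    using snoc.prems(1)[rule_format, of "length C"] by simp
  show ?case
  proof (cases "k < length C")
    case True
    have C: "\<forall>k<length C. gate_inputs (C ! k) \<subseteq> {..<k}"
      using snoc.prems(1) by (auto simp: nth_append split: if_splits)
    then have "gate_inputs (C ! k) \<subseteq> {..<length C}" using True by fastforce
    then show ?thesis
      using snoc.IH[OF C True] True by (simp add: circuit_values_snoc nth_append val)
  next
    case False
    then have "k = length C" using snoc.prems by simp
    then show ?thesis using g by (simp add: circuit_values_snoc nth_append val)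
  qed
qed simp

lemma nc_subst_tree_word: "nc_subst s (tree_word lb t) = tree_word (\<lambda>h. nc_subst s (lb h)) t"
  for lb :: "nat \<Rightarrow> ('x, 'a::comm_semiring_1) ncpoly"
  by (induction t) (simp_all add: nc_subst_mult)

lemma (in grammar) nc_subst_tree_sum:
  "nc_subst s (tree_sum lb i h) = tree_sum (\<lambda>h. nc_subst s (lb h)) i h"
  by (simp add: tree_sum_def nc_subst_sum nc_subst_mult nc_subst_tree_word)

text \<open>
  Constants are split off each gate: for \<open>j > 0\<close>, the component of degree \<open>j\<close> of every gate is a linear
  combination, with coefficients independent of \<open>j\<close>, of the inputs and of the products of components of
  positive degree at the multiplication gates. This bounds the degree of all intermediate results and
  makes the circuit a grammar in Chomsky normal form.
\<close>

locale circuit =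
  fixes C :: "('x, 'a::comm_semiring_1) circuit"
  assumes wf: "wf_circuit C"
begin

abbreviation "val \<equiv> \<lambda>g. circuit_values C ! g"

definition branch :: "nat \<Rightarrow> nat \<Rightarrow> ('x, 'a) ncpoly" where
  "branch j h = (case C ! h of
      Input x \<Rightarrow> hcomp j (nc_var x)
    | Mult l r \<Rightarrow> \<Sum>i=1..<j. hcomp i (val l) * hcomp (j - i) (val r)
    | _ \<Rightarrow> 0)"

lemma val: "g < length C \<Longrightarrow> val g = gate_value (circuit_values C) (C ! g)"
  using wf by (intro circuit_values_nth) (auto simp: wf_circuit_def)

lemma inputs: "g < length C \<Longrightarrow> gate_inputs (C ! g) \<subseteq> {..<g}"
  using wf by (auto simp: wf_circuit_def)

text \<open>The terms in which one factor has degree 0 are scalar multiples of a component of the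
  other factor; these are absorbed into linear coefficients.\<close>

lemma hcomp_mult_pos:
  fixes f g :: "('x, 'a) ncpoly"
  assumes "j > 0"
  shows "hcomp j (f * g) = nc_const (Poly_Mapping.lookup f 0) * hcomp j g +
    nc_const (Poly_Mapping.lookup g 0) * hcomp j f + (\<Sum>i=1..<j. hcomp i f * hcomp (j - i) g)"
proof -
  have "{..j} = insert 0 (insert j {1..<j})" using assms by auto
  then have "(\<Sum>i\<le>j. hcomp i f * hcomp (j - i) g) =
      hcomp 0 f * hcomp j g + (hcomp j f * hcomp 0 g + (\<Sum>i=1..<j. hcomp i f * hcomp (j - i) g))"
    using assms by simp
  then show ?thesis
    by (simp add: hcomp_mult hcomp_0_index nc_const_commute[of "hcomp j f"] add.assoc)
qed

text \<open>The order of the quantifiers matters: coefficients that do not depend on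
  \<open>j\<close> can serve as edge weights of a grammar whose states are gates, without a copy of
  each gate for every degree.\<close>

lemma hcomp_val_ex:
  "g < length C \<Longrightarrow> \<exists>a. \<forall>j>0. hcomp j (val g) = (\<Sum>h<length C. nc_const (a h) * branch j h)"
proof (induction g rule: less_induct)
  case (less g)
  have delta: "(\<Sum>h<length C. nc_const (if h = g then 1 else 0) * branch j h) = branch j g" for j
  proof -
    have "(\<Sum>h<length C. nc_const (if h = g then 1 else 0) * branch j h) =
        (\<Sum>h<length C. if h = g then branch j g else 0)"
      by (intro sum.cong) auto
    then show ?thesis using less.prems by simp
  qed
  show ?case
  proof (cases "C ! g")
    case (Input x)
    then have "hcomp j (val g) = branch j g" for j
      using less.prems by (simp add: val branch_def)
    then show ?thesis using delta by metis
  next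
    case (Const c)
    then show ?thesis
      using less.prems by (intro exI[of _ "\<lambda>_. 0"]) (simp add: val hcomp_const)
  next
    case (Add l r)
    then have "l < g" "r < g" using inputs[OF less.prems] by auto
    then obtain a b where
      a: "\<forall>j>0. hcomp j (val l) = (\<Sum>h<length C. nc_const (a h) * branch j h)" and
      b: "\<forall>j>0. hcomp j (val r) = (\<Sum>h<length C. nc_const (b h) * branch j h)"
      using less.IH less.prems by (meson less_trans)
    then show ?thesis
      using Add less.prems
      by (intro exI[of _ "\<lambda>h. a h + b h"]) (simp add: val hcomp_add nc_const_add distrib_right sum.distrib)
  next
    case (Mult l r)
    then have lr: "l < g" "r < g" using inputs[OF less.prems] by auto
    then obtain a b where
      a: "\<forall>j>0. hcomp j (val l) = (\<Sum>h<length C. nc_const (a h) * branch j h)" and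
      b: "\<forall>j>0. hcomp j (val r) = (\<Sum>h<length C. nc_const (b h) * branch j h)"
      using less.IH less.prems by (meson less_trans)
    let ?c = "Poly_Mapping.lookup (val l) 0" and ?d = "Poly_Mapping.lookup (val r) 0"
    have "hcomp j (val g) = (\<Sum>h<length C. nc_const (?c * b h + ?d * a h + (if h = g then 1 else 0)) * branch j h)"
      if "j > 0" for j
    proof -
      have "val g = val l * val r" using val[OF less.prems] Mult by simp
      then have "hcomp j (val g) = nc_const ?c * hcomp j (val r) + nc_const ?d * hcomp j (val l) + branch j g"
        using that Mult by (simp add: hcomp_mult_pos branch_def)
      also have "\<dots> = nc_const ?c * (\<Sum>h<length C. nc_const (b h) * branch j h) +
          nc_const ?d * (\<Sum>h<length C. nc_const (a h) * branch j h) +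
          (\<Sum>h<length C. nc_const (if h = g then 1 else 0) * branch j h)"
        using a b that by (simp only: delta)
      also have "\<dots> = (\<Sum>h<length C. nc_const (?c * b h + ?d * a h + (if h = g then 1 else 0)) * branch j h)"
        by (simp only: nc_const_add nc_const_mult distrib_right sum.distrib sum_distrib_left mult.assoc)
      finally show ?thesis .
    qed
    then show ?thesis by (intro exI allI impI)
  qed
qed

definition unit_weight :: "nat \<Rightarrow> nat \<Rightarrow> 'a" where
  "unit_weight g = (SOME a. \<forall>j>0. hcomp j (val g) = (\<Sum>h<length C. nc_const (a h) * branch j h))"

lemma hcomp_val:
  "g < length C \<Longrightarrow> j > 0 \<Longrightarrow>
    hcomp j (val g) = (\<Sum>h<length C. nc_const (unit_weight g h) * branch j h)"
  unfolding unit_weight_def using someI_ex[OF hcomp_val_ex[of g]] by blast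

abbreviation "s \<equiv> length C"
abbreviation "out \<equiv> val (s - 1)"

text \<open>
  States below \<open>s\<close> are the gates. State \<open>s\<close> is a leaf carrying the constant term of the output. State
  \<open>s + 1\<close> is a leaf labelled \<open>1\<close>, and \<open>s + 1\<close>, \<open>s + 2\<close> together generate for each \<open>r > 0\<close> exactly one tree
  with \<open>r\<close> leaves, all labelled \<open>1\<close>. The root \<open>s + 3\<close> uses it to pad the trees of all degrees to the same
  number of leaves.
\<close>

definition left :: "nat \<Rightarrow> nat \<Rightarrow> 'a" where
  "left h h' =
    (if h < s then case C ! h of Mult l r \<Rightarrow> if h' < s then unit_weight l h' else 0 | _ \<Rightarrow> 0
     else if h = s + 2 then if h' = s + 1 then 1 else 0
     else if h = s + 3 then if h' < s then unit_weight (s - 1) h' else if h' = s then 1 else 0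
     else 0)"

definition right :: "nat \<Rightarrow> nat \<Rightarrow> 'a" where
  "right h h' =
    (if h < s then case C ! h of Mult l r \<Rightarrow> if h' < s then unit_weight r h' else 0 | _ \<Rightarrow> 0
     else if h = s + 2 \<or> h = s + 3 then if h' = s + 1 \<or> h' = s + 2 then 1 else 0
     else 0)"

text \<open>Multiplication gates, \<open>s + 2\<close> and \<open>s + 3\<close> may only branch; the
  value 0 cancels the trees in which they are leaves.\<close>

definition letter :: "nat \<Rightarrow> ('x, 'a) ncpoly" where
  "letter h =
    (if h < s then case C ! h of Input x \<Rightarrow> nc_var x | _ \<Rightarrow> 0
     else if h = s then nc_const (Poly_Mapping.lookup out 0)
     else if h = s + 1 then 1 else 0)"

sublocale grammar "s + 4" left right .

definition T :: "nat \<Rightarrow> nat \<Rightarrow> ('x, 'a) ncpoly" where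
  "T = tree_sum letter"

lemmas T_1 = tree_sum_1[where lb=letter, folded T_def]
  and T_rec = tree_sum_rec[where lb=letter, folded T_def]

lemma sum_states: "(\<Sum>h<s + 4. f h) = (\<Sum>h<s. f h) + f s + f (s + 1) + f (s + 2) + f (s + 3)"
  for f :: "nat \<Rightarrow> 'c::comm_monoid_add"
  by (simp add: eval_nat_numeral)

text \<open>Weighted by \<open>left\<close> and \<open>right\<close>, the smaller trees add up to
  components of the two inputs of a multiplication gate, by \<open>hcomp_val\<close>. Other gates
  contribute nothing beyond degree 1.\<close>

lemma T_branch: "h < s \<Longrightarrow> j > 0 \<Longrightarrow> T j h = branch j h"
proof (induction j arbitrary: h rule: less_induct)
  case (less j)
  show ?case
  proof (cases "j = 1")
    case True
    then show ?thesis
      using less.prems T_1[of h]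
      by (simp add: letter_def branch_def hcomp_var split: gate.split)
  next
    case False
    then have j: "j \<ge> 2" using less.prems by simp
    show ?thesis
    proof (cases "\<exists>l r. C ! h = Mult l r")
      case True
      then obtain l r where h: "C ! h = Mult l r" by auto
      then have lr: "l < s" "r < s" using inputs[OF less.prems(1)] less.prems(1) by auto
      have "(\<Sum>h'<s + 4. nc_const (left h h') * T i h') = hcomp i (val l)"
        "(\<Sum>h'<s + 4. nc_const (right h h') * T i h') = hcomp i (val r)" if "0 < i" "i < j" for i
        using less.prems(1) h lr that
        by (simp_all add: sum_states left_def right_def hcomp_val less.IH)
      then show ?thesis
        using T_rec[OF j, of h] less.prems(1) h
        by (simp add: branch_def)
    next
      case False
      then have "left h h' = 0" for h'
        using less.prems by (auto simp: left_def split: gate.split)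
      then show ?thesis
        using T_rec[OF j, of h] less.prems(1) False j
        by (auto simp: branch_def hcomp_var split: gate.split)
    qed
  qed
qed

lemma T_leaf: "h = s \<or> h = s + 1 \<Longrightarrow> j > 0 \<Longrightarrow> T j h = (if j = 1 then letter h else 0)"
  using T_1[of h] T_rec[of j h] by (auto simp: left_def)

text \<open>The unique tree is a comb: a leaf \<open>s + 1\<close>, or \<open>s + 2\<close> with
  such a leaf on the left and a shorter comb on the right. The sum covers both possible
  roots.\<close>

lemma T_pad: "j > 0 \<Longrightarrow> T j (s + 1) + T j (s + 2) = 1"
proof (induction j rule: less_induct)
  case (less j)
  show ?case
  proof (cases "j = 1")
    case True
    then show ?thesis
      using T_1[of "s + 1"] T_1[of "s + 2"] by (simp add: letter_def)
  next
    case False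
    then have j: "j \<ge> 2" using less.prems by simp
    have "(\<Sum>h'<s + 4. nc_const (left (s + 2) h') * T i h') = (if i = 1 then 1 else 0)" if "i > 0" for i
      using that T_leaf[of "s + 1" i] by (simp add: sum_states left_def letter_def)
    moreover have "(\<Sum>h'<s + 4. nc_const (right (s + 2) h') * T (j - i) h') = 1" if "0 < i" "i < j" for i
      using that less.IH[of "j - i"] by (simp add: sum_states right_def)
    ultimately have "T j (s + 2) = (\<Sum>i=1..<j. if i = 1 then 1 else 0)"
      using T_rec[OF j, of "s + 2"] by simp
    then show ?thesis
      using j T_leaf[of "s + 1" j] by simp
  qed
qed

text \<open>Degree \<open>j\<close> is padded by \<open>Suc D - j\<close> leaves, at least one even
  for \<open>j = D\<close>. The constant term comes from the single leaf \<open>s\<close> and so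
  enters at \<open>j = 1\<close>, whence \<open>D > 0\<close>.\<close>

lemma T_root:
  assumes "D > 0" "nc_degree out \<le> D"
  shows "T (Suc D) (s + 3) = out"
proof -
  have s: "s > 0" using wf by (auto simp: wf_circuit_def)
  have l: "(\<Sum>h'<s + 4. nc_const (left (s + 3) h') * T j h') =
      hcomp j out + (if j = 1 then nc_const (Poly_Mapping.lookup out 0) else 0)" if "j > 0" for j
    using that s T_leaf[of s j]
    by (simp add: sum_states left_def hcomp_val T_branch letter_def)
  have r: "(\<Sum>h'<s + 4. nc_const (right (s + 3) h') * T (Suc D - j) h') = 1" if "j < Suc D" for j
    using that T_pad[of "Suc D - j"] by (simp add: sum_states right_def)
  have "T (Suc D) (s + 3) =
      (\<Sum>j=1..<Suc D. hcomp j out + (if j = 1 then nc_const (Poly_Mapping.lookup out 0) else 0))"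
    using T_rec[of "Suc D" "s + 3"] assms(1) l r by simp
  also have "\<dots> = (\<Sum>j=1..<Suc D. hcomp j out) + hcomp 0 out"
    using assms(1) by (simp add: sum.distrib hcomp_0_index)
  also have "\<dots> = (\<Sum>j\<le>D. hcomp j out)"
  proof -
    have "{..D} = insert 0 {1..<Suc D}" by auto
    then show ?thesis by (simp add: add.commute)
  qed
  also have "\<dots> = out" using assms(2) by (rule sum_hcomp)
  finally show ?thesis .
qed

end

lemma boolean_sum_projection:
  fixes g :: "('x + nat, 'a::comm_semiring_1) ncpoly"
  assumes "computes C g" and vars: "nc_vars g \<subseteq> range Inl \<union> Inr ` {..<m}"
    and K_def: "K = m + (2 * D - 1)" and N_def: "N = (length C + 4) * (Suc D * Suc D)"
    and D_def: "D = Suc (Suc (nc_degree g))"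
  shows "\<exists>n\<ge>1. n \<le> Suc (K * N) + 3 * (2 * (K * K) * (K * N)) \<and>
    projection (\<Sum>e\<in>{..<m} \<rightarrow>\<^sub>E {0, 1}. nc_subst (case_sum nc_var (\<lambda>i. nc_const (e i))) g) (HC n)"
proof -
  interpret circuit C using assms(1) by unfold_locales (simp add: computes_def)
  have "C \<noteq> []" using wf by (simp add: wf_circuit_def)
  then have out: "out = g"
    using assms(1) by (simp add: computes_def last_conv_nth flip: length_greater_0_conv)
  define bvar where "bvar h = (if h < s then case C ! h of Input (Inr q) \<Rightarrow> if q < m then Some q else None | _ \<Rightarrow> None else None)" for h
  define base :: "nat \<Rightarrow> ('x, 'a) ncpoly" where "base h =
    (if h < s then case C ! h of Input x \<Rightarrow> (case x of Inl y \<Rightarrow> nc_var y | Inr q \<Rightarrow> if q < m then 1 else 0) | _ \<Rightarrow> 0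
     else if h = s then nc_const (Poly_Mapping.lookup g 0)
     else if h = s + 1 then 1 else 0)" for h
  have base: "base h \<in> range nc_var \<union> range nc_const" for h
  proof -
    have "0 \<in> range nc_const" "1 \<in> range nc_const" by (metis nc_const_0 rangeI, metis nc_const_1 rangeI)
    then show ?thesis by (auto simp: base_def split: gate.split sum.split)
  qed
  have bvar: "bvar h = Some q \<Longrightarrow> q < m" for h q
    by (auto simp: bvar_def split: gate.splits sum.splits if_splits)
  have eq: "nc_subst (case_sum nc_var (\<lambda>i. nc_const (e i))) g =
      tree_sum (\<lambda>h. nc_const (bit_weight bvar e h) * base h) D (s + 3)" for e
  proof -
    \<comment> \<open>The circuit may read variables that cancel in \<open>g\<close>. Those with
      index at least \<open>m\<close> have no column and are set to 0, which does not change the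
      value of \<open>g\<close>.\<close>
    let ?\<sigma> = "case_sum nc_var (\<lambda>i. if i < m then nc_const (e i) else 0)"
    have "nc_subst (case_sum nc_var (\<lambda>i. nc_const (e i))) g = nc_subst ?\<sigma> g"
      using vars by (intro nc_subst_cong) (auto split: sum.split)
    \<comment> \<open>\<open>T_root\<close> needs a positive degree bound and uses one leaf more
      than that; these are the two successors in \<open>D\<close>.\<close>
    also have "\<dots> = nc_subst ?\<sigma> (T D (s + 3))"
      using T_root[of "Suc (nc_degree g)", unfolded out] by (simp add: D_def)
    also have "\<dots> = tree_sum (\<lambda>h. nc_subst ?\<sigma> (letter h)) D (s + 3)"
      unfolding T_def by (rule nc_subst_tree_sum)
    also have "(\<lambda>h. nc_subst ?\<sigma> (letter h)) = (\<lambda>h. nc_const (bit_weight bvar e h) * base h)"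
    proof
      fix h
      note defs = letter_def base_def bvar_def bit_weight_def
      show "nc_subst ?\<sigma> (letter h) = nc_const (bit_weight bvar e h) * base h"
      proof (cases "h < s")
        case True
        then show ?thesis by (cases "C ! h") (auto simp: defs split: sum.split)
      next
        case False
        then show ?thesis unfolding defs out by simp
      qed
    qed
    finally show ?thesis .
  qed
  show ?thesis
    unfolding eq by (rule tree_sum_projection) (use base bvar in \<open>auto simp: K_def N_def D_def\<close>)
qed

section \<open>Polynomial bounds and hardness\<close>

lemma p_bounded_const: "p_bounded (\<lambda>_. c)"
  by (auto simp: p_bounded_def intro!: exI[of _ "[:c:]"])

lemma p_bounded_id: "p_bounded (\<lambda>n. n)"
  by (auto simp: p_bounded_def intro!: exI[of _ "[:0, 1:]"])

lemma p_bounded_add: "p_bounded f \<Longrightarrow> p_bounded g \<Longrightarrow> p_bounded (\<lambda>n. f n + g n)"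
  unfolding p_bounded_def by (metis add_mono poly_add)

lemma p_bounded_mult: "p_bounded f \<Longrightarrow> p_bounded g \<Longrightarrow> p_bounded (\<lambda>n. f n * g n)"
  unfolding p_bounded_def by (metis mult_le_mono poly_mult)

lemma p_bounded_mono: "p_bounded g \<Longrightarrow> (\<And>n. n \<ge> 1 \<Longrightarrow> f n \<le> g n) \<Longrightarrow> p_bounded f"
  unfolding p_bounded_def by (metis order_trans)

lemmas p_bounded_intros = p_bounded_const p_bounded_id p_bounded_add p_bounded_mult

lemma VNP_p_projection_HC:
  fixes f :: "nat \<Rightarrow> ('x, 'a::comm_semiring_1) ncpoly"
  assumes "f \<in> VNP"
  shows "p_projection f HC"
proof -
  obtain m and g :: "nat \<Rightarrow> ('x + nat, 'a) ncpoly" where m: "p_bounded m" and "g \<in> VP"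
    and g: "\<And>n. n \<ge> 1 \<Longrightarrow> nc_vars (g n) \<subseteq> range Inl \<union> Inr ` {..<m n}"
      "\<And>n. n \<ge> 1 \<Longrightarrow> f n = (\<Sum>e\<in>{..<m n} \<rightarrow>\<^sub>E {0, 1}. nc_subst (case_sum nc_var (\<lambda>i. nc_const (e i))) (g n))"
    using assms by (auto simp: VNP_def)
  then obtain C where deg: "p_bounded (\<lambda>n. nc_degree (g n))" and C: "p_bounded (\<lambda>n. length (C n))"
    "\<And>n. n \<ge> 1 \<Longrightarrow> computes (C n) (g n)"
    by (auto simp: VP_def)
  define D where "D n = Suc (Suc (nc_degree (g n)))" for n
  define K where "K n = m n + (2 * D n - 1)" for n
  define N where "N n = (length (C n) + 4) * (Suc (D n) * Suc (D n))" for n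
  define B where "B n = Suc (K n * N n) + 3 * (2 * (K n * K n) * (K n * N n))" for n
  have D: "p_bounded D"
    unfolding D_def Suc_eq_plus1 by (intro p_bounded_intros deg)
  have K: "p_bounded K"
    by (rule p_bounded_mono[of "\<lambda>n. m n + 2 * D n"]) (auto simp: K_def intro!: p_bounded_intros m D)
  have N: "p_bounded N"
    unfolding N_def Suc_eq_plus1 by (intro p_bounded_intros C D)
  have B: "p_bounded B"
    unfolding B_def Suc_eq_plus1 by (intro p_bounded_intros K N)
  have "\<forall>n. \<exists>t. n \<ge> 1 \<longrightarrow> t \<ge> 1 \<and> t \<le> B n \<and> projection (f n) (HC t)"
    using boolean_sum_projection[OF C(2) g(1) K_def N_def D_def] by (metis B_def g(2))
  then obtain t where t: "\<And>n. n \<ge> 1 \<Longrightarrow> t n \<ge> 1 \<and> t n \<le> B n \<and> projection (f n) (HC (t n))"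
    by metis
  then show ?thesis
    using p_bounded_mono[OF B, of t] by (auto simp: p_projection_def)
qed

section \<open>Membership in VNP\<close>

text \<open>One derivation bounds circuit size, degree and number of variables at once. The size is
  only an upper bound, so that all factors of a product can share one.\<close>

inductive formula :: "'x set \<Rightarrow> ('x, 'a::semiring_1) ncpoly \<Rightarrow> nat \<Rightarrow> bool" for A where
  var: "x \<in> A \<Longrightarrow> formula A (nc_var x) 1"
| const: "formula A (nc_const c) 1"
| add: "formula A f s \<Longrightarrow> formula A g t \<Longrightarrow> formula A (f + g) (Suc (s + t))"
| mult: "formula A f s \<Longrightarrow> formula A g t \<Longrightarrow> formula A (f * g) (Suc (s + t))"
| weaken: "formula A f s \<Longrightarrow> s \<le> t \<Longrightarrow> formula A f t"

lemma formula_1: "formula A 1 1"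
  using formula.const[of A 1] by simp

lemma formula_prod_list:
  "(\<And>x. x \<in> set xs \<Longrightarrow> formula A (f x) s) \<Longrightarrow> formula A (prod_list (map f xs)) (Suc (length xs * Suc s))"
proof (induction xs)
  case Nil
  then show ?case using formula_1 by simp
next
  case (Cons x xs)
  then have "formula A (f x * prod_list (map f xs)) (Suc (s + Suc (length xs * Suc s)))"
    by (intro formula.mult) auto
  then show ?case by (simp add: add_ac)
qed

lemma formula_sum_list:
  "(\<And>x. x \<in> set xs \<Longrightarrow> formula A (f x) s) \<Longrightarrow> formula A (sum_list (map f xs)) (Suc (length xs * Suc s))"
proof (induction xs)
  case Nil
  then show ?case using formula.const[of A 0] by simp
next
  case (Cons x xs)
  then have "formula A (f x + sum_list (map f xs)) (Suc (s + Suc (length xs * Suc s)))"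
    by (intro formula.add) auto
  then show ?case by (simp add: add_ac)
qed

lemma formula_keys:
  "formula A f s \<Longrightarrow> w \<in> Poly_Mapping.keys f \<Longrightarrow> length (letters w) \<le> s \<and> set (letters w) \<subseteq> A"
proof (induction arbitrary: w rule: formula.induct)
  case (var x)
  then show ?case by (auto simp: nc_var_def)
next
  case (const c)
  then show ?case by (auto simp: nc_const_def zero_nc_word_def split: if_splits)
next
  case (add f s g t)
  from add.prems keys_add[of f g] have "w \<in> Poly_Mapping.keys f \<or> w \<in> Poly_Mapping.keys g" by blast
  then show ?case using add.IH by fastforce
next
  case (mult f s g t)
  from mult.prems keys_mult[of f g] obtain u v where
    w: "w = u + v" "u \<in> Poly_Mapping.keys f" "v \<in> Poly_Mapping.keys g" by blast
  then show ?case using mult.IH(1)[of u] mult.IH(2)[of v] by (auto simp: plus_nc_word_def)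
qed fastforce

lemma formula_nc_vars: "formula A f s \<Longrightarrow> nc_vars f \<subseteq> A"
  using formula_keys unfolding nc_vars_def by blast

lemma formula_nc_degree: "formula A f s \<Longrightarrow> nc_degree f \<le> s"
  using formula_keys unfolding nc_degree_def by (subst Max_le_iff) auto

lemma finite_nc_vars [simp]: "finite (nc_vars f)"
  by (simp add: nc_vars_def)

lemma formula_card_nc_vars: "formula A f s \<Longrightarrow> card (nc_vars f) \<le> s"
proof (induction rule: formula.induct)
  case (add f s g t)
  have "nc_vars (f + g) \<subseteq> nc_vars f \<union> nc_vars g"
    using keys_add[of f g] by (auto simp: nc_vars_def)
  then have "card (nc_vars (f + g)) \<le> card (nc_vars f \<union> nc_vars g)"
    by (intro card_mono) auto
  also have "\<dots> \<le> card (nc_vars f) + card (nc_vars g)" by (rule card_Un_le)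
  finally show ?case using add.IH by simp
next
  case (mult f s g t)
  have "nc_vars (f * g) \<subseteq> nc_vars f \<union> nc_vars g"
    using keys_mult[of f g] by (fastforce simp: nc_vars_def plus_nc_word_def)
  then have "card (nc_vars (f * g)) \<le> card (nc_vars f \<union> nc_vars g)"
    by (intro card_mono) auto
  also have "\<dots> \<le> card (nc_vars f) + card (nc_vars g)" by (rule card_Un_le)
  finally show ?case using mult.IH by simp
qed (auto simp: nc_vars_def nc_var_def nc_const_def zero_nc_word_def)

section \<open>Circuits from formulas\<close>

fun shift_gate :: "nat \<Rightarrow> ('x, 'a) gate \<Rightarrow> ('x, 'a) gate" where
  "shift_gate n (Input x) = Input x"
| "shift_gate n (Const c) = Const c"
| "shift_gate n (Add i j) = Add (n + i) (n + j)"
| "shift_gate n (Mult i j) = Mult (n + i) (n + j)"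

lemma circuit_values_shift:
  "circuit_values (C @ map (shift_gate (length C)) C') = circuit_values C @ circuit_values C'"
proof (induction C' rule: rev_induct)
  case Nil
  then show ?case by (simp add: circuit_values_def[of "[]"])
next
  case (snoc g C')
  have "gate_value (circuit_values C @ circuit_values C') (shift_gate (length C) g) =
      gate_value (circuit_values C') g"
    by (cases g) (simp_all add: nth_append)
  then show ?case
    using snoc circuit_values_snoc[of "C @ map (shift_gate (length C)) C'"] by (simp add: circuit_values_snoc)
qed

lemma gate_inputs_shift: "gate_inputs (shift_gate n g) = (+) n ` gate_inputs g"
  by (cases g) auto

lemma computes_binary:
  assumes "computes C f" "computes C' f'"
    and inp: "gate_inputs g = {length C - 1, length C + length C' - 1}"
    and val: "\<And>vs. gate_value vs g = h (vs ! (length C - 1)) (vs ! (length C + length C' - 1))"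
  shows "computes (C @ map (shift_gate (length C)) C' @ [g]) (h f f')"
proof -
  let ?D = "C @ map (shift_gate (length C)) C'"
  have wf: "wf_circuit C" "wf_circuit C'" and last: "last (circuit_values C) = f" "last (circuit_values C') = f'"
    using assms by (auto simp: computes_def)
  then have ne: "C \<noteq> []" "C' \<noteq> []" by (auto simp: wf_circuit_def)
  have "gate_inputs ((?D @ [g]) ! k) \<subseteq> {..<k}" if k: "k < length (?D @ [g])" for k
  proof -
    consider "k < length C" | "length C \<le> k" "k < length C + length C'" | "k = length C + length C'"
      using k by (cases "k < length C"; cases "k < length C + length C'") auto
    then show ?thesis
    proof cases
      case 1
      then show ?thesis using wf(1) by (simp add: nth_append wf_circuit_def)
    next
      case 2
      then have "gate_inputs (C' ! (k - length C)) \<subseteq> {..<k - length C}"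
        using wf(2) by (simp add: wf_circuit_def)
      moreover have "(?D @ [g]) ! k = shift_gate (length C) (C' ! (k - length C))"
      proof -
        have "k - length C < length C'" using 2 by linarith
        then show ?thesis using 2(1) by (simp add: nth_append)
      qed
      ultimately show ?thesis using 2 by (auto simp: gate_inputs_shift)
    next
      case 3
      then show ?thesis using inp ne by (auto simp: nth_append neq_Nil_conv)
    qed
  qed
  then have "wf_circuit (?D @ [g])" by (auto simp: wf_circuit_def)
  moreover have "last (circuit_values (?D @ [g])) = h f f'"
    using last ne
    by (simp only: circuit_values_snoc circuit_values_shift last_snoc val)
      (auto simp: nth_append last_conv_nth neq_Nil_conv simp flip: length_greater_0_conv length_0_conv)
  ultimately show ?thesis by (simp add: computes_def)
qed

lemma formula_computes:
  "formula A f s \<Longrightarrow> \<exists>C. computes C f \<and> length C \<le> s"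
proof (induction rule: formula.induct)
  case (var x)
  show ?case
    by (rule exI[of _ "[Input x]"]) (simp add: computes_def wf_circuit_def circuit_values_def)
next
  case (const c)
  show ?case
    by (rule exI[of _ "[Const c]"]) (simp add: computes_def wf_circuit_def circuit_values_def)
next
  case (add f s g t)
  then obtain C C' where C: "computes C f" "length C \<le> s" "computes C' g" "length C' \<le> t" by blast
  from computes_binary[OF C(1,3), of "Add (length C - 1) (length C + length C' - 1)" "(+)"] C
  show ?case by (intro exI conjI) auto
next
  case (mult f s g t)
  then obtain C C' where C: "computes C f" "length C \<le> s" "computes C' g" "length C' \<le> t" by blast
  from computes_binary[OF C(1,3), of "Mult (length C - 1) (length C + length C' - 1)" "(*)"] C
  show ?case by (intro exI conjI) auto
qed (meson order_trans)

lemma formula_VP: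
  assumes "p_bounded s" "\<And>n. n \<ge> 1 \<Longrightarrow> formula (A n) (f n) (s n)"
  shows "f \<in> VP"
proof -
  have "\<forall>n. \<exists>C. n \<ge> 1 \<longrightarrow> computes C (f n) \<and> length C \<le> s n"
    using formula_computes[OF assms(2)] by blast
  then obtain C where "\<And>n. n \<ge> 1 \<Longrightarrow> computes (C n) (f n) \<and> length (C n) \<le> s n"
    by metis
  then show ?thesis
    unfolding VP_def
    by (intro CollectI conjI exI[of _ C] p_bounded_mono[OF assms(1)] allI impI
        formula_nc_degree[OF assms(2)] formula_card_nc_vars[OF assms(2)]) auto
qed

section \<open>The verifier polynomial\<close>

context
  fixes n :: nat
begin

text \<open>Row \<open>k\<close> is a position on the cycle, and column \<open>i\<close> stands for
  the vertex \<open>i + 1\<close>.\<close>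

definition cell :: "nat \<Rightarrow> nat \<Rightarrow> ((nat \<times> nat) + nat, 'a::comm_ring_1) ncpoly" where
  "cell k i = nc_var (Inr (k * n + i))"

text \<open>
  For boolean values, the clash factors say that \<open>cell\<close> has at most one \<open>1\<close> in every row and column; the
  step factors vanish unless every row has one.
\<close>

definition clash :: "(nat \<times> nat) \<times> (nat \<times> nat) \<Rightarrow> ((nat \<times> nat) + nat, 'a::comm_ring_1) ncpoly" where
  "clash = (\<lambda>((k, i), (l, j)).
     if (k = l) = (i = j) then 1 else 1 + nc_const (- 1) * (cell k i * cell l j))"

definition grid :: "(nat \<times> nat) list" where
  "grid = List.product [0..<n] [0..<n]"

text \<open>The index \<open>Suc k mod n\<close> closes the cycle: the last step returns to the
  vertex at position 0.\<close>

definition step :: "nat \<Rightarrow> ((nat \<times> nat) + nat, 'a::comm_ring_1) ncpoly" where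
  "step k = sum_list (map (\<lambda>(i, j).
     cell k i * cell (Suc k mod n) j * nc_var (Inl (Suc i, Suc j))) grid)"

text \<open>The factor \<open>cell 0 0\<close> puts vertex 1 first; otherwise every cycle would also
  contribute the other rotations of its word.\<close>

definition HC_verifier :: "((nat \<times> nat) + nat, 'a::comm_ring_1) ncpoly" where
  "HC_verifier = prod_list (map clash (List.product grid grid)) * (cell 0 0 * prod_list (map step [0..<n]))"

end

lemma set_grid [simp]: "set (grid n) = {..<n} \<times> {..<n}"
  by (auto simp: grid_def)

lemma cell_index: "k < n \<Longrightarrow> i < n \<Longrightarrow> k * n + i < n * n" for k i n :: nat
proof -
  assume "k < n" "i < n"
  then have "k * n + i < Suc k * n" by simp
  also have "\<dots> \<le> n * n" using \<open>k < n\<close> by (intro mult_right_mono) auto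
  finally show ?thesis .
qed

lemma formula_HC_verifier:
  assumes "n \<ge> 1"
  shows "formula (range Inl \<union> Inr ` {..<n * n}) (HC_verifier n :: (_, 'a::comm_ring_1) ncpoly)
    (Suc (Suc (n * n * (n * n) * Suc 7) + Suc (1 + Suc (n * Suc (Suc (n * n * Suc 5))))))"
    (is "formula ?A _ _")
proof -
  have cell: "formula ?A (cell n k i :: (_, 'a) ncpoly) 1" if "k < n" "i < n" for k i
    unfolding cell_def using cell_index[OF that] by (intro formula.var) auto
  have clash: "formula ?A (clash n x :: (_, 'a) ncpoly) 7" if "x \<in> set (List.product (grid n) (grid n))" for x
  proof -
    obtain k i l j where x: "x = ((k, i), (l, j))" "k < n" "i < n" "l < n" "j < n"
      using \<open>x \<in> _\<close> by auto
    have "formula ?A (1 + nc_const (- 1) * (cell n k i * cell n l j) :: (_, 'a) ncpoly)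
        (Suc (1 + Suc (1 + Suc (1 + 1))))"
      using x by (intro formula.add formula.mult formula.const formula_1 cell)
    moreover have "formula ?A (1 :: (_, 'a) ncpoly) 7"
      by (rule formula.weaken[OF formula_1]) simp
    ultimately show ?thesis
      using x by (auto simp: clash_def eval_nat_numeral)
  qed
  have step: "formula ?A (step n k :: (_, 'a) ncpoly) (Suc (n * n * Suc 5))" if "k < n" for k
  proof -
    have "formula ?A ((case x of (i, j) \<Rightarrow> cell n k i * cell n (Suc k mod n) j * nc_var (Inl (Suc i, Suc j))) :: (_, 'a) ncpoly) 5"
      if xg: "x \<in> set (grid n)" for x
    proof -
      obtain i j where x: "x = (i, j)" "i < n" "j < n" using xg by auto
      have "formula ?A (cell n k i * cell n (Suc k mod n) j * nc_var (Inl (Suc i, Suc j)) :: (_, 'a) ncpoly)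
          (Suc (Suc (1 + 1) + 1))"
        using x \<open>k < n\<close> assms by (intro formula.mult cell formula.var) auto
      then show ?thesis using x by (simp add: eval_nat_numeral)
    qed
    from formula_sum_list[of "grid n", OF this] show ?thesis
      by (simp add: step_def grid_def)
  qed
  have "formula ?A (prod_list (map (clash n) (List.product (grid n) (grid n))) :: (_, 'a) ncpoly)
      (Suc (length (List.product (grid n) (grid n)) * Suc 7))"
    by (rule formula_prod_list) (rule clash)
  moreover have "formula ?A (prod_list (map (step n) [0..<n]) :: (_, 'a) ncpoly) (Suc (length [0..<n] * Suc (Suc (n * n * Suc 5))))"
    by (rule formula_prod_list) (use step in auto)
  ultimately show ?thesis
    unfolding HC_verifier_def using assms by (intro formula.mult cell) (auto simp: grid_def)
qed

section \<open>The verifier on 0/1 matrices\<close>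

context
  fixes n :: nat and e :: "nat \<Rightarrow> 'a::comm_ring_1"
begin

abbreviation "inst \<equiv> case_sum nc_var (\<lambda>i. nc_const (e i))"

lemma inst_cell: "nc_subst inst (cell n k i) = nc_const (e (k * n + i))"
  by (simp add: cell_def)

lemma inst_clash: "nc_subst inst (clash n ((k, i), (l, j))) =
    (if (k = l) = (i = j) then 1 else nc_const (1 - e (k * n + i) * e (l * n + j)))"
  by (auto simp: clash_def nc_subst_add nc_subst_mult inst_cell nc_const_add[symmetric] nc_const_mult[symmetric]
      simp flip: nc_const_1)

lemma inst_step: "nc_subst inst (step n k) = (\<Sum>(i, j)\<in>{..<n} \<times> {..<n}.
    nc_const (e (k * n + i) * e (Suc k mod n * n + j)) * nc_var (Suc i, Suc j))"
proof -
  have "distinct (grid n)" by (simp add: grid_def distinct_product)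
  then show ?thesis
    unfolding step_def nc_subst_sum_list map_map
    by (simp add: sum_list_distinct_conv_sum_set o_def case_prod_beta' nc_subst_mult inst_cell nc_const_mult)
qed

lemma inst_verifier: "nc_subst inst (HC_verifier n) =
    prod_list (map (\<lambda>x. nc_subst inst (clash n x)) (List.product (grid n) (grid n))) *
    (nc_const (e 0) * prod_list (map (\<lambda>k. nc_subst inst (step n k)) [0..<n]))"
  by (simp add: HC_verifier_def nc_subst_mult nc_subst_prod_list o_def inst_cell)

end

text \<open>The restriction makes it a member of the extensional function space over which the
  verifier is summed.\<close>

definition position_matrix :: "nat \<Rightarrow> nat list \<Rightarrow> nat \<Rightarrow> 'a::comm_ring_1" where
  "position_matrix n xs = (\<lambda>q\<in>{..<n * n}. if xs ! (q div n) = Suc (q mod n) then 1 else 0)"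

lemma position_matrix_cell:
  "k < n \<Longrightarrow> i < n \<Longrightarrow> position_matrix n xs (k * n + i) = (if xs ! k = Suc i then 1 else 0)"
  using cell_index[of k n i] by (simp add: position_matrix_def)

lemma verifier_ham_list:
  assumes n: "n \<ge> 1" and xs: "xs \<in> ham_lists {1..n} 1"
  shows "nc_subst (inst (position_matrix n xs)) (HC_verifier n) =
    (walk (\<lambda>i j. nc_var (i, j)) (xs @ [1]) :: (_, 'a::comm_ring_1) ncpoly)"
proof -
  let ?e = "position_matrix n xs :: nat \<Rightarrow> 'a"
  have x: "distinct xs" "set xs = {1..n}" "xs \<noteq> []" "xs ! 0 = 1"
    using xs by (auto simp: ham_lists_def hd_conv_nth)
  then have len: "length xs = n" using distinct_card[of xs] by simp
  have "nc_subst (inst ?e) (clash n y) = 1" if "y \<in> set (List.product (grid n) (grid n))" for y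
  proof -
    obtain k i l j where y: "y = ((k, i), (l, j))" "k < n" "i < n" "l < n" "j < n"
      using \<open>y \<in> _\<close> by auto
    have "(k = l) = (i = j)" if "xs ! k = Suc i" "xs ! l = Suc j"
      using that y len x(1) by (metis Suc_inject nth_eq_iff_index_eq)
    then show ?thesis using y by (auto simp: inst_clash position_matrix_cell)
  qed
  then have "map (\<lambda>x. nc_subst (inst ?e) (clash n x)) (List.product (grid n) (grid n)) =
      map (\<lambda>x. 1) (List.product (grid n) (grid n))"
    by (intro map_cong) auto
  then have 1: "prod_list (map (\<lambda>x. nc_subst (inst ?e) (clash n x)) (List.product (grid n) (grid n))) = 1"
    by (simp only: map_replicate_const) (simp add: prod_list_replicate)
  have 2: "?e 0 = 1"
    using position_matrix_cell[of 0 n 0 xs] n x(4) by simp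
  have step: "nc_subst (inst ?e) (step n k) = nc_var ((xs @ [1]) ! k, (xs @ [1]) ! Suc k)" if k: "k < n" for k
  proof -
    let ?k' = "Suc k mod n"
    have k': "?k' < n" using n by simp
    have "xs ! k \<in> {1..n}" "xs ! ?k' \<in> {1..n}" using k k' x(2) len by (metis nth_mem)+
    then obtain a b where ab: "xs ! k = Suc a" "xs ! ?k' = Suc b" "a < n" "b < n"
      by (metis atLeastAtMost_iff Suc_le_D Suc_le_lessD One_nat_def)
    have "nc_subst (inst ?e) (step n k) = (\<Sum>(i, j)\<in>{..<n} \<times> {..<n}. if (i, j) = (a, b) then nc_var (Suc a, Suc b) else 0)"
      unfolding inst_step using k k' ab by (intro sum.cong) (auto simp: position_matrix_cell)
    also have "\<dots> = (\<Sum>x\<in>{..<n} \<times> {..<n}. if x = (a, b) then nc_var (Suc a, Suc b) else 0)"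
      by (intro sum.cong refl) (simp add: case_prod_beta prod_eq_iff)
    also have "\<dots> = nc_var (xs ! k, xs ! ?k')" using ab by simp
    also have "xs ! k = (xs @ [1]) ! k" using k len by (simp add: nth_append)
    also have "xs ! ?k' = (xs @ [1]) ! Suc k" using k len x(4) by (cases "Suc k = n") (auto simp: nth_append)
    finally show ?thesis .
  qed
  have "prod_list (map (\<lambda>k. nc_subst (inst ?e) (step n k)) [0..<n]) =
      prod_list (map (\<lambda>k. nc_var ((xs @ [1]) ! k, (xs @ [1]) ! Suc k)) [0..<n])"
    using step by (intro arg_cong[where f=prod_list] map_cong) auto
  then show ?thesis
    unfolding inst_verifier 1 2 walk_nth using len by simp
qed

text \<open>No factor vanishes. The step factors give a 1 in each row, and the clash factors make it
  unique and the resulting map injective. An injective map of \<open>n\<close> numbers to themselves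
  is a permutation, and \<open>e 0\<close> makes it start at vertex 1.\<close>

lemma verifier_nonzero:
  assumes n: "n \<ge> 1" and e: "e \<in> {..<n * n} \<rightarrow>\<^sub>E {0, 1}"
    and nz: "nc_subst (inst e) (HC_verifier n) \<noteq> (0 :: (_, 'a::comm_ring_1) ncpoly)"
  shows "\<exists>xs\<in>ham_lists {1..n} 1. e = position_matrix n xs"
proof -
  have nz': "0 \<notin> set (map (\<lambda>x. nc_subst (inst e) (clash n x)) (List.product (grid n) (grid n)))"
    "e 0 \<noteq> 0" "0 \<notin> set (map (\<lambda>k. nc_subst (inst e) (step n k)) [0..<n])"
    using nz prod_list_zero unfolding inst_verifier by fastforce+
  have e01: "e (k * n + i) \<in> {0, 1}" if "k < n" "i < n" for k i
    using PiE_mem[OF e] cell_index[OF that] by blast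
  have agree: "(k = l) = (i = j)"
    if "k < n" "i < n" "l < n" "j < n" "e (k * n + i) \<noteq> 0" "e (l * n + j) \<noteq> 0" for k l i j
  proof (rule ccontr)
    assume *: "(k = l) \<noteq> (i = j)"
    have "e (k * n + i) = 1" "e (l * n + j) = 1" using e01 that by auto
    then have "nc_subst (inst e) (clash n ((k, i), (l, j))) = 0"
      using * by (auto simp: inst_clash)
    moreover have "((k, i), (l, j)) \<in> set (List.product (grid n) (grid n))" using that by simp
    ultimately show False using nz'(1) by (metis (no_types, lifting) image_eqI set_map)
  qed
  have "\<exists>i<n. e (k * n + i) \<noteq> 0" if k: "k < n" for k
  proof (rule ccontr)
    assume "\<not> ?thesis"
    then have "nc_subst (inst e) (step n k) = 0"
      unfolding inst_step by (intro sum.neutral) auto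
    then show False using nz'(3) k by force
  qed
  then obtain \<pi> where \<pi>: "\<And>k. k < n \<Longrightarrow> \<pi> k < n \<and> e (k * n + \<pi> k) \<noteq> 0" by metis
  have row: "e (k * n + i) = (if i = \<pi> k then 1 else 0)" if "k < n" "i < n" for k i
  proof (cases "i = \<pi> k")
    case True
    then show ?thesis using \<pi>[OF that(1)] e01[OF that] by auto
  next
    case False
    then show ?thesis using agree[of k i k "\<pi> k"] \<pi>[OF that(1)] that by auto
  qed
  let ?xs = "map (\<lambda>k. Suc (\<pi> k)) [0..<n]"
  have "inj_on \<pi> {..<n}"
  proof (rule inj_onI)
    fix x y assume "x \<in> {..<n}" "y \<in> {..<n}" "\<pi> x = \<pi> y"
    then show "x = y" using agree[of x "\<pi> x" y "\<pi> y"] \<pi>[of x] \<pi>[of y] by auto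
  qed
  then have d: "distinct ?xs"
    by (auto simp: distinct_map inj_on_def)
  moreover have "set ?xs = {1..n}"
  proof (rule card_subset_eq)
    show "set ?xs \<subseteq> {1..n}" using \<pi> by (auto simp: Suc_le_eq)
    show "card (set ?xs) = card {1..n}" using distinct_card[OF d] by simp
  qed simp
  moreover have "\<pi> 0 = 0" using row[of 0 0] n nz'(2) by (auto split: if_splits)
  ultimately have "?xs \<in> ham_lists {1..n} 1"
    using n by (auto simp: ham_lists_def hd_map)
  moreover have "e = position_matrix n ?xs"
  proof
    fix q
    show "e q = position_matrix n ?xs q"
    proof (cases "q < n * n")
      case True
      then have "q div n < n" "q mod n < n" using n by (auto simp: less_mult_imp_div_less)
      then show ?thesis
        using row[of "q div n" "q mod n"] True by (auto simp: position_matrix_def)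
    next
      case False
      then show ?thesis using PiE_arb[OF e, of q] by (simp add: position_matrix_def)
    qed
  qed
  ultimately show ?thesis by blast
qed

lemma position_matrix_inj: "inj_on (position_matrix n :: _ \<Rightarrow> nat \<Rightarrow> 'a::comm_ring_1) (ham_lists {1..n} 1)"
proof (rule inj_onI)
  fix xs ys assume xs: "xs \<in> ham_lists {1..n} 1" and ys: "ys \<in> ham_lists {1..n} 1"
    and eq: "position_matrix n xs = (position_matrix n ys :: nat \<Rightarrow> 'a)"
  have len: "length xs = n" "length ys = n"
    using xs ys by (auto simp: ham_lists_def dest: distinct_card)
  show "xs = ys"
  proof (rule nth_equalityI)
    fix k assume "k < length xs"
    then have k: "k < n" using len by simp
    then have "xs ! k \<in> {1..n}" using xs len by (metis (mono_tags, lifting) ham_lists_def mem_Collect_eq nth_mem)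
    then obtain i where i: "xs ! k = Suc i" "i < n" by (cases "xs ! k") auto
    have "position_matrix n ys (k * n + i) = (1 :: 'a)"
      using position_matrix_cell[OF k i(2), of xs] i(1) by (simp flip: eq)
    then show "xs ! k = ys ! k"
      using position_matrix_cell[OF k i(2), of ys, where 'a='a] i(1) by (auto split: if_splits)
  qed (use len in simp)
qed

lemma HC_VNP: "(HC :: nat \<Rightarrow> (nat \<times> nat, 'a::comm_ring_1) ncpoly) \<in> VNP"
proof -
  let ?P = "\<lambda>n e. nc_subst (inst e) (HC_verifier n) :: (nat \<times> nat, 'a) ncpoly"
  have sum: "HC n = (\<Sum>e\<in>{..<n * n} \<rightarrow>\<^sub>E {0, 1}. ?P n e)" if n: "n \<ge> 1" for n
  proof -
    have "(\<Sum>e\<in>{..<n * n} \<rightarrow>\<^sub>E {0, 1}. ?P n e) = (\<Sum>e\<in>position_matrix n ` ham_lists {1..n} 1. ?P n e)"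
    proof (rule sum.mono_neutral_right)
      show "position_matrix n ` ham_lists {1..n} 1 \<subseteq> {..<n * n} \<rightarrow>\<^sub>E {0, 1}"
        by (simp add: position_matrix_def image_subset_iff restrict_PiE_iff)
    qed (use verifier_nonzero[OF n] in \<open>auto intro: finite_PiE\<close>)
    also have "\<dots> = (\<Sum>xs\<in>ham_lists {1..n} 1. ?P n (position_matrix n xs))"
      by (subst sum.reindex[OF position_matrix_inj]) (simp add: o_def)
    also have "\<dots> = HC n"
      unfolding HC_ham_lists[OF n] by (intro sum.cong refl verifier_ham_list n)
    finally show ?thesis ..
  qed
  have "p_bounded (\<lambda>n. Suc (Suc (n * n * (n * n) * Suc 7) + Suc (1 + Suc (n * Suc (Suc (n * n * Suc 5))))))"
    unfolding Suc_eq_plus1 by (intro p_bounded_intros)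
  then have "(\<lambda>n. HC_verifier n :: (_, 'a) ncpoly) \<in> VP"
    using formula_HC_verifier by (rule formula_VP)
  moreover have "p_bounded (\<lambda>n. n * n)" by (intro p_bounded_intros)
  ultimately show ?thesis
    unfolding VNP_def using sum formula_nc_vars[OF formula_HC_verifier] by blast
qed

theorem theorem5p3:
  "VNP_complete TYPE('x) (HC :: nat \<Rightarrow> (nat \<times> nat, 'a::field_char_0) ncpoly)"
  unfolding VNP_complete_def using HC_VNP VNP_p_projection_HC by blast

end
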